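(* Let $X_0,X_1,\dots,X_n$ be smooth vector fields on a domain $\Omega\subset\mathbb{R}^p$, free up to weight $r$ and satisfying Hörmander's condition of step $r$ in $\Omega$, and let $B$ be a set of $p$ multiindices of weight $\le r$ such that $\{X_{[I]}\}_{I\in B}$ is a basis of $\mathbb{R}^p$ at every point of $\Omega$. (i) For any $\xi_0\in\Omega$ there exist a neighborhood $W$ of $(\xi_0,\xi_0)$ in $\mathbb{R}^{2p}$, a neighborhood $U(0)$ of $0$ in $\mathbb{R}^p$ and a smooth map $\Theta(\cdot,\cdot):W\to U(0)$ such that $$\xi=\exp\Bigl(\sum_{I\in B}u_IX_{[I]}\Bigr)(\eta)\quad\text{for }u=\Theta(\eta,\xi).$$ (ii) The map $\Theta$ satisfies $\Theta(\eta,\xi)=-\Theta(\xi,\eta)$. (iii) For any fixed $\eta$, the map $\xi\mapsto u=\Theta(\eta,\xi)$ is a diffeomorphism from a neighborhood of $\eta$ onto a neighborhood of $0$ in $\mathbb{R}^p$. (iv) Analogously, for any fixed $\xi$, the map $\eta\mapsto u=\Theta(\eta,\xi)$ is a diffeomorphism from a neighborhood of $\xi$ onto a neighborhood of $0$.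
   Context: Weights and commutators: $X_0$ has weight $p_0=2$, $X_i$ has weight $p_i=1$ for $i\ge1$. For $I=(i_1,\dots,i_k)$, $i_j\in\{0,\dots,n\}$, $|I|=\sum_j p_{i_j}$ and $X_{[I]}=[X_{i_1},[X_{i_2},\dots[X_{i_{k-1}},X_{i_k}]\dots]]$, $X_{[(i)]}=X_i$. Hörmander's condition of step $r$ in $\Omega$: $\{(X_{[I]})_x\}_{|I|\le r}$ spans $\mathbb{R}^p$ for every $x\in\Omega$. In noncommuting indeterminates $\xi_0,\dots,\xi_n$ write $\xi_{[I]}=[\xi_{i_1},[\dots,\xi_{i_k}]\dots]=\sum_JA_{IJ}\xi_J$. The fields are free up to weight $r$ in $\Omega$ if at each $x\in\Omega$: $\sum_{|I|\le r}a_I(X_{[I]})_x=0$ (real constants $a_I$) implies $\sum_{|I|\le r} a_IA_{IJ}=0$ for all $J$. Here $u=(u_I)_{I\in B}\in\mathbb{R}^p$, and $\exp(Z)(\eta)$ denotes the time-1 value of the solution of $\phi'(\tau)=Z_{\phi(\tau)}$, $\phi(0)=\eta$. *)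

theory Defs
  imports "HOL-Analysis.Analysis"
begin

text \<open>Intended for open \<open>S\<close>, where it is the class \<open>C\<^sup>k\<close>: \<open>f\<close> is \<open>C\<^bsup>k+1\<^esup>\<close> iff it is differentiable
  and all its directional derivatives are \<open>C\<^sup>k\<close>.\<close>

fun Ck_on :: "nat \<Rightarrow> 'a::euclidean_space set \<Rightarrow> ('a \<Rightarrow> 'b::real_normed_vector) \<Rightarrow> bool" where
  "Ck_on 0 S f \<longleftrightarrow> continuous_on S f"
| "Ck_on (Suc k) S f \<longleftrightarrow>
     (\<forall>x\<in>S. f differentiable (at x)) \<and>
     (\<forall>v. Ck_on k S (\<lambda>x. frechet_derivative f (at x) v))"

definition smooth_on :: "'a::euclidean_space set \<Rightarrow> ('a \<Rightarrow> 'b::real_normed_vector) \<Rightarrow> bool" where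
  "smooth_on S f \<longleftrightarrow> (\<forall>k. Ck_on k S f)"

definition diffeomorphism ::
    "'a::euclidean_space set \<Rightarrow> 'b::euclidean_space set \<Rightarrow> ('a \<Rightarrow> 'b) \<Rightarrow> bool" where
  "diffeomorphism S T f \<longleftrightarrow>
     open S \<and> open T \<and> bij_betw f S T \<and> smooth_on S f \<and> smooth_on T (inv_into S f)"

text \<open>A multiindex \<open>(i\<^sub>1, \<dots>, i\<^sub>k)\<close> is the nonempty list \<open>[i\<^sub>1, \<dots>, i\<^sub>k]\<close>.\<close>

definition weight :: "nat list \<Rightarrow> nat" where
  "weight I = (\<Sum>i\<leftarrow>I. if i = 0 then 2 else 1)"

definition multiindices :: "nat \<Rightarrow> nat \<Rightarrow> nat list set" where
  "multiindices n r = {I. I \<noteq> [] \<and> set I \<subseteq> {0..n} \<and> weight I \<le> r}"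

lemma finite_multiindices: "finite (multiindices n r)"
proof (rule finite_subset)
  have "length I \<le> weight I" for I
    by (induction I) (auto simp: weight_def)
  then show "multiindices n r \<subseteq> {I. set I \<subseteq> {0..n} \<and> length I \<le> r}"
    unfolding multiindices_def using le_trans by blast
qed (rule finite_lists_length_le, simp)

text \<open>\<open>iter_bracket br [a\<^sub>1, \<dots>, a\<^sub>k] = br a\<^sub>1 (br a\<^sub>2 (\<dots> (br a\<^bsub>k-1\<^esub> a\<^sub>k)))\<close>; unspecified on the empty list.\<close>

fun iter_bracket :: "('a \<Rightarrow> 'a \<Rightarrow> 'a) \<Rightarrow> 'a list \<Rightarrow> 'a" where
  "iter_bracket br [a] = a"
| "iter_bracket br (a # b # as) = br a (iter_bracket br (b # as))"

text \<open>Identifying a vector field \<open>X\<close> with the derivation \<open>f \<mapsto> (x \<mapsto> Df(x)(X x))\<close>, the commutator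
  \<open>X Y - Y X\<close> is the field \<open>x \<mapsto> DY(x)(X x) - DX(x)(Y x)\<close>.\<close>

definition lie_bracket ::
    "('a \<Rightarrow> 'a) \<Rightarrow> ('a \<Rightarrow> 'a) \<Rightarrow> 'a \<Rightarrow> 'a::euclidean_space" where
  "lie_bracket X Y =
     (\<lambda>x. frechet_derivative Y (at x) (X x) - frechet_derivative X (at x) (Y x))"

definition comm_field ::
    "(nat \<Rightarrow> 'a \<Rightarrow> 'a) \<Rightarrow> nat list \<Rightarrow> 'a \<Rightarrow> 'a::euclidean_space" where
  "comm_field X I = iter_bracket lie_bracket (map X I)"

text \<open>A polynomial in noncommuting indeterminates \<open>\<xi>\<^sub>0, \<xi>\<^sub>1, \<dots>\<close> is given by its coefficient function:
  \<open>P J\<close> is the coefficient of the monomial \<open>\<xi>\<^sub>J = \<xi>\<^bsub>j1\<^esub> \<dots> \<xi>\<^bsub>jk\<^esub>\<close>. The product is induced by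
  concatenation of monomials.\<close>

type_synonym nc_poly = "nat list \<Rightarrow> real"

definition nc_var :: "nat \<Rightarrow> nc_poly" where
  "nc_var i = (\<lambda>J. if J = [i] then 1 else 0)"

definition nc_mult :: "nc_poly \<Rightarrow> nc_poly \<Rightarrow> nc_poly" where
  "nc_mult P Q = (\<lambda>J. \<Sum>k\<le>length J. P (take k J) * Q (drop k J))"

definition nc_bracket :: "nc_poly \<Rightarrow> nc_poly \<Rightarrow> nc_poly" where
  "nc_bracket P Q = (\<lambda>J. nc_mult P Q J - nc_mult Q P J)"

text \<open>The coefficients \<open>A\<^sub>I\<^sub>J\<close> in \<open>\<xi>\<^bsub>[I]\<^esub> = (\<Sum>J. A\<^sub>I\<^sub>J \<xi>\<^sub>J)\<close>.\<close>

definition comm_coeff :: "nat list \<Rightarrow> nat list \<Rightarrow> real" where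
  "comm_coeff I J = iter_bracket nc_bracket (map nc_var I) J"

definition hoermander_condition ::
    "nat \<Rightarrow> nat \<Rightarrow> 'a::euclidean_space set \<Rightarrow> (nat \<Rightarrow> 'a \<Rightarrow> 'a) \<Rightarrow> bool" where
  "hoermander_condition n r \<Omega> X \<longleftrightarrow>
     (\<forall>x\<in>\<Omega>. span ((\<lambda>I. comm_field X I x) ` multiindices n r) = UNIV)"

definition free_up_to_weight ::
    "nat \<Rightarrow> nat \<Rightarrow> 'a::euclidean_space set \<Rightarrow> (nat \<Rightarrow> 'a \<Rightarrow> 'a) \<Rightarrow> bool" where
  "free_up_to_weight n r \<Omega> X \<longleftrightarrow>
     (\<forall>x\<in>\<Omega>. \<forall>a :: nat list \<Rightarrow> real.
        (\<Sum>I\<in>multiindices n r. a I *\<^sub>R comm_field X I x) = 0 \<longrightarrow>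
        (\<forall>J. (\<Sum>I\<in>multiindices n r. a I * comm_coeff I J) = 0))"

definition pointwise_basis ::
    "'a::euclidean_space set \<Rightarrow> (nat \<Rightarrow> 'a \<Rightarrow> 'a) \<Rightarrow> nat list set \<Rightarrow> bool" where
  "pointwise_basis \<Omega> X B \<longleftrightarrow>
     (\<forall>x\<in>\<Omega>. inj_on (\<lambda>I. comm_field X I x) B \<and>
             independent ((\<lambda>I. comm_field X I x) ` B) \<and>
             span ((\<lambda>I. comm_field X I x) ` B) = UNIV)"

text \<open>\<open>has_exp \<Omega> Z \<eta> \<xi>\<close>: the integral curve of \<open>Z\<close> starting at \<open>\<eta>\<close> exists in \<open>\<Omega>\<close> up to time 1, and
  \<open>exp(Z)(\<eta>) = \<xi>\<close>. For \<open>Z\<close> smooth on the open set \<open>\<Omega>\<close> there is at most one such \<open>\<xi>\<close>.\<close>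

definition has_exp ::
    "'a::euclidean_space set \<Rightarrow> ('a \<Rightarrow> 'a) \<Rightarrow> 'a \<Rightarrow> 'a \<Rightarrow> bool" where
  "has_exp \<Omega> Z \<eta> \<xi> \<longleftrightarrow>
     (\<exists>\<phi> :: real \<Rightarrow> 'a.
        (\<forall>\<tau>\<in>{0..1}. \<phi> \<tau> \<in> \<Omega> \<and> (\<phi> has_vector_derivative Z (\<phi> \<tau>)) (at \<tau> within {0..1})) \<and>
        \<phi> 0 = \<eta> \<and> \<phi> 1 = \<xi>)"

end

(* The path u |-> exp(sum u_k Y_k)(eta), Y_k = X_[idx k], is the fixed point of a Picard operator on
   bounded continuous paths that is a contraction for small u. Its derivatives in (u, eta) solve a
   linear fixed point equation whose coefficients involve only the path, so smooth dependence follows by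
   bootstrapping. Since d/du exp(...)(eta) at u = 0 is the basis (Y_k(eta)), the map
   (u, eta) |-> (eta, exp(sum u_k Y_k)(eta)) is a local diffeomorphism at (0, xi_0), and Theta is the first
   component of its inverse. Reversing time gives exp(-Z)(exp(Z)(eta)) = eta, i.e. the involution
   (u, eta) |-> (-u, exp(sum u_k Y_k)(eta)) corresponds to swapping (eta, xi); restricting to an invariant
   neighbourhood yields the antisymmetry, and the slices of the diffeomorphism give (iii) and (iv). *)

theory Submission
  imports Defs
begin

subsection \<open>Calculus of \<open>C\<^sup>k\<close> maps\<close>

text \<open>\<open>Ck_on\<close> has a Euclidean domain and controls derivatives along fixed vectors
  only. The superposition operator \<open>\<phi> \<mapsto> Y o \<phi>\<close> acts on an
  infinite-dimensional path space, so it gets one Frechet derivative by hand, and higher order is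
  claimed only for its composition with a path that depends on a finite-dimensional parameter. A
  derivative in a moving direction is expanded over \<open>Basis\<close> into coordinates times
  derivatives along fixed vectors. The same expansion brings each linearized equation into the form
  \<open>y = w + (\<Sum>j. p j (m j) y)\<close> with bounded bilinear \<open>p j\<close>; one
  regularity lemma for such equations serves twice, for the paths and for the derivative of a local
  inverse, where it replaces the smoothness of matrix inversion. Nothing is known about the fields
  outside \<open>\<Omega>\<close>, and a Picard iterate might leave it. The fields are therefore
  evaluated at points clamped to a box in \<open>\<Omega>\<close>, which makes the operators total
  and globally Lipschitz, so that the contraction principle applies on the whole path space. That
  the true path stays in the box is shown afterwards.\<close>

lemma Ck_on_cong:
  assumes "open S" "\<And>x. x \<in> S \<Longrightarrow> f x = g x" "Ck_on k S f"
  shows "Ck_on k S g"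
  using assms(2,3)
proof (induction k arbitrary: f g)
  case 0
  then show ?case by (auto cong: continuous_on_cong)
next
  case (Suc k)
  have g': "(g has_derivative frechet_derivative f (at x)) (at x)" if "x \<in> S" for x
  proof (rule has_derivative_transform_within_open[OF _ assms(1) that])
    show "(f has_derivative frechet_derivative f (at x)) (at x)"
      using Suc.prems(2) that by (simp add: frechet_derivative_works[symmetric])
  qed (rule Suc.prems(1))
  have "Ck_on k S (\<lambda>x. frechet_derivative g (at x) v)" for v
  proof (rule Suc.IH)
    show "Ck_on k S (\<lambda>x. frechet_derivative f (at x) v)"
      using Suc.prems by simp
    show "frechet_derivative f (at x) v = frechet_derivative g (at x) v" if "x \<in> S" for x
      by (simp only: frechet_derivative_at[OF g'[OF that]])
  qed
  with g' show ?case
    by (auto simp: differentiable_def)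
qed

text \<open>Uniqueness of the derivative lets any explicit candidate \<open>f'\<close> replace the
  chosen \<open>frechet_derivative\<close>; most inductions on \<open>k\<close> below raise the
  order through this rule.\<close>

lemma Ck_on_has_derivativeI:
  assumes "open S" and f': "\<And>x. x \<in> S \<Longrightarrow> (f has_derivative f' x) (at x)"
    and "\<And>v. Ck_on k S (\<lambda>x. f' x v)"
  shows "Ck_on (Suc k) S f"
  unfolding Ck_on.simps
proof (intro conjI ballI allI)
  show "f differentiable at x" if "x \<in> S" for x
    using f'[OF that] by (auto simp: differentiable_def)
  show "Ck_on k S (\<lambda>x. frechet_derivative f (at x) v)" for v
  proof (rule Ck_on_cong[OF assms(1)])
    show "f' x v = frechet_derivative f (at x) v" if "x \<in> S" for x
      by (simp only: frechet_derivative_at[OF f'[OF that]])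
  qed (rule assms(3))
qed

lemma Ck_on_has_derivativeD:
  assumes "Ck_on (Suc k) S f" "x \<in> S"
  shows "(f has_derivative frechet_derivative f (at x)) (at x)"
  using assms by (simp add: frechet_derivative_works)

lemma Ck_on_frechet_derivative:
  "Ck_on (Suc k) S f \<Longrightarrow> Ck_on k S (\<lambda>x. frechet_derivative f (at x) v)"
  by simp

lemma Ck_on_SucD: "Ck_on (Suc k) S f \<Longrightarrow> Ck_on k S f"
proof (induction k arbitrary: f)
  case 0
  then show ?case
    by (auto intro!: continuous_at_imp_continuous_on differentiable_imp_continuous_within)
next
  case (Suc k)
  have "Ck_on k S (\<lambda>x. frechet_derivative f (at x) v)" for v
    using Suc.IH[of "\<lambda>x. frechet_derivative f (at x) v"] Suc.prems by simp
  then show ?case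
    using Suc.prems by simp
qed

lemma Ck_on_imp_continuous_on: "Ck_on k S f \<Longrightarrow> continuous_on S f"
  by (induction k) (auto dest: Ck_on_SucD simp del: Ck_on.simps(2))

lemma Ck_on_subset: "Ck_on k S f \<Longrightarrow> T \<subseteq> S \<Longrightarrow> Ck_on k T f"
  by (induction k arbitrary: f) (auto intro: continuous_on_subset)

lemma Ck_on_const: "Ck_on k S (\<lambda>x. c)"
  by (induction k arbitrary: c) auto

lemma Ck_on_linear:
  assumes "open S" "bounded_linear L"
  shows "Ck_on k S L"
proof (cases k)
  case 0
  then show ?thesis
    using assms by (simp add: linear_continuous_on)
next
  case (Suc m)
  show ?thesis
    unfolding Suc
    using assms bounded_linear_imp_has_derivative
    by (intro Ck_on_has_derivativeI[where f' = "\<lambda>_. L"]) (auto intro: Ck_on_const)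
qed

lemma Ck_on_bounded_linear:
  assumes "open S" "bounded_linear L" "Ck_on k S f"
  shows "Ck_on k S (\<lambda>x. L (f x))"
  using assms(3)
proof (induction k arbitrary: f)
  case 0
  then show ?case
    using bounded_linear.continuous_on[OF assms(2)] by simp
next
  case (Suc k)
  show ?case
  proof (rule Ck_on_has_derivativeI[OF assms(1)])
    show "((\<lambda>x. L (f x)) has_derivative (\<lambda>v. L (frechet_derivative f (at x) v))) (at x)"
      if "x \<in> S" for x
      by (rule bounded_linear.has_derivative[OF assms(2) Ck_on_has_derivativeD[OF Suc.prems that]])
    show "Ck_on k S (\<lambda>x. L (frechet_derivative f (at x) v))" for v
      by (rule Suc.IH[OF Ck_on_frechet_derivative[OF Suc.prems]])
  qed
qed

lemma Ck_on_add:
  assumes "open S" "Ck_on k S f" "Ck_on k S g"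
  shows "Ck_on k S (\<lambda>x. f x + g x)"
  using assms(2,3)
proof (induction k arbitrary: f g)
  case 0
  then show ?case by (auto intro: continuous_intros)
next
  case (Suc k)
  show ?case
  proof (rule Ck_on_has_derivativeI[OF assms(1)])
    show "((\<lambda>x. f x + g x) has_derivative
        (\<lambda>v. frechet_derivative f (at x) v + frechet_derivative g (at x) v)) (at x)"
      if "x \<in> S" for x
      using Suc.prems that by (intro has_derivative_add Ck_on_has_derivativeD)
    show "Ck_on k S (\<lambda>x. frechet_derivative f (at x) v + frechet_derivative g (at x) v)" for v
      using Suc.prems by (intro Suc.IH Ck_on_frechet_derivative)
  qed
qed

lemma Ck_on_diff:
  assumes "open S" "Ck_on k S f" "Ck_on k S g"
  shows "Ck_on k S (\<lambda>x. f x - g x)"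
  using Ck_on_add[OF assms(1,2) Ck_on_bounded_linear[OF assms(1) bounded_linear_minus[OF bounded_linear_ident] assms(3)]]
  by simp

lemma Ck_on_sum:
  assumes "open S" "\<And>i. i \<in> J \<Longrightarrow> Ck_on k S (f i)"
  shows "Ck_on k S (\<lambda>x. \<Sum>i\<in>J. f i x)"
  using assms(2)
  by (induction J rule: infinite_finite_induct) (auto intro: Ck_on_const Ck_on_add assms(1))

lemma Ck_on_bilinear:
  assumes "open S" "bounded_bilinear p" "Ck_on k S f" "Ck_on k S g"
  shows "Ck_on k S (\<lambda>x. p (f x) (g x))"
  using assms(3,4)
proof (induction k arbitrary: f g)
  case 0
  then show ?case
    using bounded_bilinear.continuous_on[OF assms(2)] by simp
next
  case (Suc k)
  show ?case
  proof (rule Ck_on_has_derivativeI[OF assms(1)])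
    show "((\<lambda>x. p (f x) (g x)) has_derivative
        (\<lambda>v. p (f x) (frechet_derivative g (at x) v) + p (frechet_derivative f (at x) v) (g x)))
        (at x)" if "x \<in> S" for x
      using Suc.prems that by (intro bounded_bilinear.FDERIV[OF assms(2)] Ck_on_has_derivativeD)
    show "Ck_on k S (\<lambda>x. p (f x) (frechet_derivative g (at x) v) +
        p (frechet_derivative f (at x) v) (g x))" for v
      using Suc.prems
      by (intro Suc.IH Ck_on_add assms(1) Ck_on_frechet_derivative) (auto intro: Ck_on_SucD simp del: Ck_on.simps(2))
  qed
qed

lemma bounded_linear_euclidean_expansion:
  fixes L :: "'a::euclidean_space \<Rightarrow> 'b::real_normed_vector"
  assumes "bounded_linear L"
  shows "L v = (\<Sum>i\<in>Basis. (v \<bullet> i) *\<^sub>R L i)"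
proof -
  interpret bounded_linear L by fact
  have "L v = L (\<Sum>i\<in>Basis. (v \<bullet> i) *\<^sub>R i)"
    by (simp add: euclidean_representation)
  then show ?thesis
    by (simp add: sum scaleR)
qed

lemma Ck_on_expansion:
  assumes "Ck_on (Suc k) S f" "x \<in> S"
  shows "frechet_derivative f (at x) v = (\<Sum>i\<in>Basis. (v \<bullet> i) *\<^sub>R frechet_derivative f (at x) i)"
  by (rule bounded_linear_euclidean_expansion)
    (rule has_derivative_bounded_linear[OF Ck_on_has_derivativeD[OF assms]])

text \<open>The chain rule evaluates the derivative of \<open>g\<close> in the moving direction
  \<open>Df(x) v\<close>, about which \<open>Ck_on\<close> says nothing. Expanding that direction
  over the basis of the intermediate space, which is why this space is Euclidean, leaves products of
  maps known to be of class k.\<close>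

lemma Ck_on_compose:
  fixes f :: "'a::euclidean_space \<Rightarrow> 'b::euclidean_space"
  assumes "open S" "open T" "f ` S \<subseteq> T" "Ck_on k S f" "Ck_on k T g"
  shows "Ck_on k S (\<lambda>x. g (f x))"
  using assms(4,5)
proof (induction k arbitrary: g)
  case 0
  then show ?case
    using assms(3) by (auto intro: continuous_on_compose2)
next
  case (Suc k)
  let ?D = "\<lambda>x v. \<Sum>i\<in>Basis.
    (frechet_derivative f (at x) v \<bullet> i) *\<^sub>R frechet_derivative g (at (f x)) i"
  show ?case
  proof (rule Ck_on_has_derivativeI[OF assms(1)])
    show "((\<lambda>x. g (f x)) has_derivative ?D x) (at x)" if "x \<in> S" for x
    proof -
      have fx: "f x \<in> T"
        using assms(3) that by auto
      have "((\<lambda>x. g (f x)) has_derivative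
          (\<lambda>v. frechet_derivative g (at (f x)) (frechet_derivative f (at x) v))) (at x)"
        by (rule has_derivative_compose[OF Ck_on_has_derivativeD[OF Suc.prems(1) that]
              Ck_on_has_derivativeD[OF Suc.prems(2) fx]])
      then show ?thesis
        by (simp only: Ck_on_expansion[OF Suc.prems(2) fx, symmetric])
    qed
    show "Ck_on k S (\<lambda>x. ?D x v)" for v
    proof (intro Ck_on_sum Ck_on_bilinear[OF _ bounded_bilinear_scaleR] assms(1))
      show "Ck_on k S (\<lambda>x. frechet_derivative f (at x) v \<bullet> i)" for i
        by (rule Ck_on_bounded_linear[OF assms(1) bounded_linear_inner_left
              Ck_on_frechet_derivative[OF Suc.prems(1)]])
      show "Ck_on k S (\<lambda>x. frechet_derivative g (at (f x)) i)" for i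
        by (rule Suc.IH[OF Ck_on_SucD[OF Suc.prems(1)] Ck_on_frechet_derivative[OF Suc.prems(2)]])
    qed
  qed
qed

lemma Ck_on_Pair:
  assumes "open S" "Ck_on k S f" "Ck_on k S g"
  shows "Ck_on k S (\<lambda>x. (f x, g x))"
proof -
  have "bounded_linear (\<lambda>x. (x, 0 :: 'c))" "bounded_linear (\<lambda>y. (0 :: 'b, y))"
    by (auto intro: bounded_linear_Pair bounded_linear_ident bounded_linear_zero)
  from Ck_on_add[OF assms(1) Ck_on_bounded_linear[OF assms(1) this(1) assms(2)]
      Ck_on_bounded_linear[OF assms(1) this(2) assms(3)]]
  show ?thesis by simp
qed

subsection \<open>Fixed points depending on a parameter\<close>

text \<open>\<open>R\<close> is the inverse of \<open>id - A\<close>. The contraction principle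
  yields it pointwise, uniqueness of the fixed point makes it linear, and absorbing half of
  \<open>norm (R x)\<close> bounds it by 2.\<close>

lemma half_contraction_resolvent:
  fixes A :: "'v::banach \<Rightarrow> 'v"
  assumes A: "bounded_linear A" and half: "\<And>v. norm (A v) \<le> norm v / 2"
  obtains R where "bounded_linear R" "\<And>w. R w = w + A (R w)"
proof -
  interpret bounded_linear A by fact
  have "\<exists>!z. w + A z = z" for w
  proof (rule banach_fix_type[of "1/2"])
    show "\<forall>x y. dist (w + A x) (w + A y) \<le> 1 / 2 * dist x y"
      using half by (auto simp: dist_norm diff[symmetric])
  qed auto
  then obtain R where R: "\<And>w. w + A (R w) = R w" and uniq: "\<And>w z. w + A z = z \<Longrightarrow> z = R w"
    by metis
  have "bounded_linear R"
  proof
    show "R (x + y) = R x + R y" for x y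
    proof -
      have "(x + y) + A (R x + R y) = (x + A (R x)) + (y + A (R y))"
        by (simp add: add)
      then show ?thesis
        using uniq[of "x + y" "R x + R y"] R by simp
    qed
    show "R (r *\<^sub>R x) = r *\<^sub>R R x" for r x
    proof -
      have "r *\<^sub>R x + A (r *\<^sub>R R x) = r *\<^sub>R (x + A (R x))"
        by (simp add: scaleR algebra_simps)
      then show ?thesis
        using uniq[of "r *\<^sub>R x" "r *\<^sub>R R x"] R by simp
    qed
    show "\<exists>K. \<forall>x. norm (R x) \<le> norm x * K"
    proof (intro exI allI)
      fix x
      have "norm (R x) \<le> norm x + norm (A (R x))"
        by (metis R norm_triangle_ineq)
      then show "norm (R x) \<le> norm x * 2"
        using half[of "R x"] by simp
    qed
  qed
  with R that show ?thesis by metis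
qed

text \<open>An implicit function theorem at a single point. Differentiability of \<open>F\<close>
  along \<open>S \<times> Q\<close> is enough because the graph of \<open>y\<close> stays there. The
  resolvent solves the linearized equation, which gives the candidate \<open>y'\<close>; the
  remainder of \<open>F\<close> then controls the error of this candidate.\<close>

lemma fixed_point_has_derivative:
  fixes F :: "'l::real_normed_vector \<times> 'v::banach \<Rightarrow> 'v"
  assumes F: "(F has_derivative F') (at (x, y x) within S \<times> Q)"
    and S: "open S" "x \<in> S"
    and y: "\<And>z. z \<in> S \<Longrightarrow> y z = F (z, y z)" "\<And>z. z \<in> S \<Longrightarrow> y z \<in> Q"
    and cont: "continuous (at x) y"
    and half: "\<And>v. norm (F' (0, v)) \<le> norm v / 2"
  obtains y' where "(y has_derivative y') (at x)" "\<And>h. y' h = F' (h, y' h)"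
proof -
  have F': "bounded_linear F'"
    using F by (rule has_derivative_bounded_linear)
  interpret F': bounded_linear F' by fact
  have "bounded_linear (\<lambda>v. F' (0, v))"
    by (rule bounded_linear_compose[OF F']) (auto intro: bounded_linear_Pair bounded_linear_ident bounded_linear_zero)
  then obtain R where R: "bounded_linear R" "\<And>w. R w = w + F' (0, R w)"
    using half_contraction_resolvent half by blast
  define y' where "y' h = R (F' (h, 0))" for h
  have F'_split: "F' (h, v) = F' (h, 0) + F' (0, v)" for h v
    using F'.add[of "(h, 0)" "(0, v)"] by simp
  have y': "y' h = F' (h, y' h)" for h
    unfolding y'_def by (subst R(2)) (rule F'_split[symmetric])
  have "bounded_linear y'"
    unfolding y'_def
    by (rule bounded_linear_compose[OF R(1)], rule bounded_linear_compose[OF F'])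
      (auto intro: bounded_linear_Pair bounded_linear_ident bounded_linear_zero)
  obtain K where K: "K > 0" "\<And>z. norm (F' z) \<le> norm z * K"
    using F'.pos_bounded by blast
  have remainder: "\<exists>d>0. \<forall>z. norm (z - x) < d \<longrightarrow> z \<in> S \<and> norm (y z - y x - F' (z - x, y z - y x))
      \<le> e * (norm (z - x) + norm (y z - y x))" if "e > 0" for e
  proof -
    obtain d where d: "d > 0" "\<And>w. w \<in> S \<times> Q \<Longrightarrow> norm (w - (x, y x)) < d \<Longrightarrow>
        norm (F w - F (x, y x) - F' (w - (x, y x))) \<le> e * norm (w - (x, y x))"
      using F \<open>e > 0\<close> unfolding has_derivative_within_alt by metis
    obtain d1 where d1: "d1 > 0" "\<And>z. dist z x < d1 \<Longrightarrow> dist (y z) (y x) < d / 2"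
      using cont \<open>d > 0\<close> unfolding continuous_at_eps_delta
      by (metis half_gt_zero)
    obtain d2 where d2: "d2 > 0" "\<And>z. dist z x < d2 \<Longrightarrow> z \<in> S"
      using S unfolding open_dist by metis
    show ?thesis
    proof (intro exI[of _ "min (d/2) (min d1 d2)"] conjI allI impI)
      show "0 < min (d / 2) (min d1 d2)"
        using d d1 d2 by simp
      fix z assume z: "norm (z - x) < min (d / 2) (min d1 d2)"
      then show zS: "z \<in> S"
        using d2 by (simp add: dist_norm)
      have le: "norm (z - x, y z - y x) \<le> norm (z - x) + norm (y z - y x)"
        by (rule norm_Pair_le)
      also have "\<dots> < d"
        using z d1(2)[of z] by (simp add: dist_norm)
      finally have "norm (F (z, y z) - F (x, y x) - F' (z - x, y z - y x))
          \<le> e * norm (z - x, y z - y x)"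
        using d(2)[of "(z, y z)"] zS y(2) by simp
      also have "\<dots> \<le> e * (norm (z - x) + norm (y z - y x))"
        using le \<open>e > 0\<close> by simp
      finally show "norm (y z - y x - F' (z - x, y z - y x)) \<le> e * (norm (z - x) + norm (y z - y x))"
        using y(1)[OF zS] y(1)[OF S(2)] by simp
    qed
  qed
  have "(y has_derivative y') (at x)"
    unfolding has_derivative_at_alt
  proof (intro conjI allI impI)
    fix e :: real assume "e > 0"
    \<comment> \<open>\<open>C\<close> is the Lipschitz constant of \<open>y\<close> at
      \<open>x\<close>: with remainder at most a quarter of
      \<open>norm (z - x) + norm (y z - y x)\<close>, three quarters of
      \<open>norm (y z - y x)\<close> are absorbed, leaving \<open>K + 1/4\<close> against one
      quarter. In \<open>e'\<close>, the factor \<open>1 + C\<close> bounds the sum of both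
      increments, and the 2 pays for absorbing \<open>norm q / 2\<close> below.\<close>
    define C where "C = 4 * K + 1"
    define e' where "e' = min (1/4) (e / (2 * (1 + C)))"
    have C: "C > 0" using K by (simp add: C_def)
    have e': "e' > 0" "e' \<le> 1/4"
      unfolding e'_def using \<open>e > 0\<close> C by (simp, intro min.cobounded1)
    have "e' \<le> e / (2 * (1 + C))"
      by (simp add: e'_def)
    then have e'_le: "e' * (2 * (1 + C)) \<le> e"
      using C by (simp add: pos_le_divide_eq)
    obtain d where d: "d > 0" "\<And>z. norm (z - x) < d \<Longrightarrow>
       norm (y z - y x - F' (z - x, y z - y x)) \<le> e' * (norm (z - x) + norm (y z - y x))"
      using remainder[OF e'(1)] by blast
    show "\<exists>d>0. \<forall>z. norm (z - x) < d \<longrightarrow> norm (y z - y x - y' (z - x)) \<le> e * norm (z - x)"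
    proof (intro exI[of _ d] conjI allI impI d(1))
      fix z assume z: "norm (z - x) < d"
      let ?r = "y z - y x - F' (z - x, y z - y x)"
      have "norm (y z - y x) \<le> norm ?r + norm (F' (z - x, 0)) + norm (F' (0, y z - y x))"
        using norm_triangle_ineq[of "?r + F' (z - x, 0)" "F' (0, y z - y x)"]
          norm_triangle_ineq[of ?r "F' (z - x, 0)"] F'_split[of "z - x" "y z - y x"] by simp
      also have "\<dots> \<le> norm ?r + K * norm (z - x) + norm (y z - y x) / 2"
        using K(2)[of "(z - x, 0)"] half[of "y z - y x"] by (simp add: norm_Pair mult.commute)
      also have "norm ?r \<le> 1/4 * (norm (z - x) + norm (y z - y x))"
        using d(2)[OF z] mult_right_mono[OF e'(2), of "norm (z - x) + norm (y z - y x)"] by simp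
      finally have Lip: "norm (y z - y x) \<le> C * norm (z - x)"
        by (simp add: C_def algebra_simps)
      \<comment> \<open>The error of the candidate derivative. It solves
        \<open>q = ?r + F' (0, q)\<close>, so it is at most twice the remainder
        \<open>?r\<close>.\<close>
      define q where "q = y z - y x - y' (z - x)"
      have "F' (z - x, y z - y x) = F' (z - x, y' (z - x)) + F' (0, q)"
        using F'.add[of "(z - x, y' (z - x))" "(0, q)"] by (simp add: q_def)
      then have "q = ?r + F' (0, q)"
        using y'[of "z - x"] by (simp add: q_def)
      then have "norm q = norm (?r + F' (0, q))"
        by (rule arg_cong)
      then have "norm q \<le> norm ?r + norm q / 2"
        using norm_triangle_ineq[of ?r "F' (0, q)"] half[of q] by linarith
      then have "norm q \<le> 2 * (e' * (norm (z - x) + norm (y z - y x)))"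
        using d(2)[OF z] by linarith
      also have "\<dots> \<le> 2 * (e' * (norm (z - x) + C * norm (z - x)))"
        using Lip e'(1) by simp
      also have "\<dots> = (e' * (2 * (1 + C))) * norm (z - x)"
        by (simp add: algebra_simps)
      also have "\<dots> \<le> e * norm (z - x)"
        using e'_le by (rule mult_right_mono) simp
      finally show "norm (y z - y x - y' (z - x)) \<le> e * norm (z - x)"
        by (simp add: q_def)
    qed
  qed fact
  with y' that show ?thesis by blast
qed

text \<open>Continuity of \<open>F\<close> in the parameter for each frozen \<open>v\<close>
  suffices: the contraction gives
  \<open>norm (y z - y x) \<le> 2 * norm (F (z, y x) - F (x, y x))\<close>, in which only the value
  \<open>y x\<close> occurs.\<close>

lemma fixed_point_continuous_on:
  fixes F :: "'l::metric_space \<times> 'v::real_normed_vector \<Rightarrow> 'v"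
  assumes half: "\<And>x u v. x \<in> S \<Longrightarrow> norm (F (x, u) - F (x, v)) \<le> norm (u - v) / 2"
    and F: "\<And>v. continuous_on S (\<lambda>x. F (x, v))"
    and y: "\<And>x. x \<in> S \<Longrightarrow> y x = F (x, y x)"
  shows "continuous_on S y"
  unfolding continuous_on
proof
  fix x assume x: "x \<in> S"
  have bound: "norm (y z - y x) \<le> 2 * norm (F (z, y x) - F (x, y x))" if z: "z \<in> S" for z
  proof -
    have "y z - y x = (F (z, y z) - F (z, y x)) + (F (z, y x) - F (x, y x))"
      using y[OF z] y[OF x] by simp
    then have "norm (y z - y x) = norm ((F (z, y z) - F (z, y x)) + (F (z, y x) - F (x, y x)))"
      by (rule arg_cong)
    also have "\<dots> \<le> norm (F (z, y z) - F (z, y x)) + norm (F (z, y x) - F (x, y x))"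
      by (rule norm_triangle_ineq)
    also have "norm (F (z, y z) - F (z, y x)) \<le> norm (y z - y x) / 2"
      by (rule half[OF z])
    finally show ?thesis by simp
  qed
  have "((\<lambda>z. F (z, y x)) \<longlongrightarrow> F (x, y x)) (at x within S)"
    using F x unfolding continuous_on by blast
  then have "((\<lambda>z. 2 * norm (F (z, y x) - F (x, y x))) \<longlongrightarrow> 2 * norm (F (x, y x) - F (x, y x))) (at x within S)"
    by (intro tendsto_intros)
  then have lim: "((\<lambda>z. 2 * norm (F (z, y x) - F (x, y x))) \<longlongrightarrow> 0) (at x within S)"
    by simp
  have "((\<lambda>z. y z - y x) \<longlongrightarrow> 0) (at x within S)"
    using bound by (intro Lim_null_comparison[OF _ lim]) (auto simp: eventually_at_filter)
  then show "(y \<longlongrightarrow> y x) (at x within S)"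
    by (rule Lim_null[THEN iffD2])
qed

lemma Ck_on_has_derivative_fst:
  assumes "Ck_on (Suc k) S f" "x \<in> S"
  shows "((\<lambda>z. f (fst z)) has_derivative (\<lambda>h. frechet_derivative f (at x) (fst h))) (at (x, y))"
proof -
  have "(f has_derivative frechet_derivative f (at x)) (at (fst (x, y)))"
    using Ck_on_has_derivativeD[OF assms] by simp
  from has_derivative_compose[OF has_derivative_fst[OF has_derivative_ident] this] show ?thesis .
qed

text \<open>The directional derivatives of \<open>y\<close> satisfy a fixed point equation with the same linear part
  and a new inhomogeneous term that involves only \<open>y\<close> itself; hence one induction on \<open>k\<close> suffices.\<close>

lemma Ck_on_linear_fixed_point:
  fixes y :: "'l::euclidean_space \<Rightarrow> 'v::banach"
    and m :: "'j \<Rightarrow> 'l \<Rightarrow> 'w::real_normed_vector"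
  assumes S: "open S"
    and p: "\<And>j. j \<in> J \<Longrightarrow> bounded_bilinear (p j)"
    and m: "\<And>j. j \<in> J \<Longrightarrow> Ck_on k S (m j)"
    and w: "Ck_on k S w"
    and y: "\<And>x. x \<in> S \<Longrightarrow> y x = w x + (\<Sum>j\<in>J. p j (m j x) (y x))"
    and half: "\<And>x v. x \<in> S \<Longrightarrow> norm (\<Sum>j\<in>J. p j (m j x) v) \<le> norm v / 2"
  shows "Ck_on k S y"
  using m w y
proof (induction k arbitrary: w y)
  case (0 w y)
  have diff: "(\<Sum>j\<in>J. p j (m j x) u) - (\<Sum>j\<in>J. p j (m j x) v) = (\<Sum>j\<in>J. p j (m j x) (u - v))" for x u v
    by (simp add: sum_subtractf bounded_bilinear.diff_right[OF p])
  have "continuous_on S y"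
  proof (rule fixed_point_continuous_on[where F = "\<lambda>(x, v). w x + (\<Sum>j\<in>J. p j (m j x) v)"])
    have "continuous_on S w" "continuous_on S (m j)" if "j \<in> J" for j
      using 0 that by simp_all
    then show "continuous_on S (\<lambda>x. case (x, v) of (x, v) \<Rightarrow> w x + (\<Sum>j\<in>J. p j (m j x) v))" for v
      using 0(2) unfolding prod.case
      by (intro continuous_on_add continuous_on_sum bounded_bilinear.continuous_on[OF p] continuous_on_const)
        simp_all
    show "norm ((case (x, u) of (x, v) \<Rightarrow> w x + (\<Sum>j\<in>J. p j (m j x) v)) -
        (case (x, v) of (x, v) \<Rightarrow> w x + (\<Sum>j\<in>J. p j (m j x) v))) \<le> norm (u - v) / 2"
      if "x \<in> S" for x u v
      using half[OF that] by (simp add: diff)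
    show "y x = (case (x, y x) of (x, v) \<Rightarrow> w x + (\<Sum>j\<in>J. p j (m j x) v))" if "x \<in> S" for x
      unfolding prod.case by (rule 0(3)[OF that])
  qed
  then show ?case by simp
next
  case (Suc k w y)
  let ?F = "\<lambda>z. w (fst z) + (\<Sum>j\<in>J. p j (m j (fst z)) (snd z))"
  let ?F' = "\<lambda>x h. frechet_derivative w (at x) (fst h) + (\<Sum>j\<in>J. p j (m j x) (snd h) +
    p j (frechet_derivative (m j) (at x) (fst h)) (y x))"
  \<comment> \<open>The induction hypothesis is used twice: here for \<open>y\<close> itself, and at
    the end for \<open>y' x v\<close>, whose inhomogeneous term \<open>?w\<close> contains
    \<open>y\<close>.\<close>
  have Ck: "Ck_on k S y"
    by (rule Suc.IH[OF Ck_on_SucD[OF Suc.prems(1)] Ck_on_SucD[OF Suc.prems(2)] Suc.prems(3)])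
  have "\<exists>y'. (y has_derivative y') (at x) \<and> (\<forall>h. y' h = ?F' x (h, y' h))" if x: "x \<in> S" for x
  proof -
    note fst = Ck_on_has_derivative_fst[where k = k, OF _ x]
    have "(?F has_derivative ?F' x) (at (x, y x))"
    proof (intro has_derivative_add has_derivative_sum fst Suc.prems(2))
      show "((\<lambda>z. p j (m j (fst z)) (snd z)) has_derivative (\<lambda>h. p j (m j x) (snd h) +
          p j (frechet_derivative (m j) (at x) (fst h)) (y x))) (at (x, y x))" if "j \<in> J" for j
        using bounded_bilinear.FDERIV[OF p[OF that] fst[OF Suc.prems(1)[OF that]]
            has_derivative_snd[OF has_derivative_ident]] by simp
    qed
    then have "(?F has_derivative ?F' x) (at (x, y x) within S \<times> UNIV)"
      by (rule has_derivative_at_withinI)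
    then show ?thesis
    proof (rule fixed_point_has_derivative[OF _ S x])
      show "y z = ?F (z, y z)" if "z \<in> S" for z
        unfolding fst_conv snd_conv by (rule Suc.prems(3)[OF that])
      show "continuous (at x) y"
        using Ck_on_imp_continuous_on[OF Ck] S x by (simp add: continuous_on_eq_continuous_at)
      have "frechet_derivative w (at x) 0 = 0"
        by (rule linear_0[OF has_derivative_linear[OF Ck_on_has_derivativeD[OF Suc.prems(2) x]]])
      moreover have "p j (frechet_derivative (m j) (at x) 0) v = 0" if "j \<in> J" for j v
        using linear_0[OF has_derivative_linear[OF Ck_on_has_derivativeD[OF Suc.prems(1)[OF that] x]]]
        by (simp add: bounded_bilinear.zero_left[OF p[OF that]])
      ultimately show "norm (?F' x (0, v)) \<le> norm v / 2" for v
        using half[OF x] by simp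
    qed auto
  qed
  then have "\<exists>y'. \<forall>x\<in>S. (y has_derivative y' x) (at x) \<and> (\<forall>h. y' x h = ?F' x (h, y' x h))"
    by (intro bchoice ballI)
  then obtain y' where y': "\<And>x. x \<in> S \<Longrightarrow> (y has_derivative y' x) (at x)"
    "\<And>x h. x \<in> S \<Longrightarrow> y' x h = ?F' x (h, y' x h)"
    by blast
  show ?case
  proof (rule Ck_on_has_derivativeI[OF S y'(1)])
    fix v
    let ?w = "\<lambda>x. frechet_derivative w (at x) v + (\<Sum>j\<in>J. p j (frechet_derivative (m j) (at x) v) (y x))"
    show "Ck_on k S (\<lambda>x. y' x v)"
    proof (rule Suc.IH)
      show "Ck_on k S (m j)" if "j \<in> J" for j
        using Suc.prems(1)[OF that] by (rule Ck_on_SucD)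
      show "Ck_on k S ?w"
        using Suc.prems(1,2) Ck by (intro Ck_on_add Ck_on_sum Ck_on_bilinear[OF S p] S Ck_on_frechet_derivative)
      show "y' x v = ?w x + (\<Sum>j\<in>J. p j (m j x) (y' x v))" if "x \<in> S" for x
        by (rule trans[OF y'(2)[OF that]]) (simp add: sum.distrib algebra_simps)
    qed
  qed
qed

subsection \<open>Local inverses\<close>

lemma Ck_on_frechet_derivative_compose:
  fixes g :: "'a::euclidean_space \<Rightarrow> 'b::euclidean_space"
  assumes "open S" "open T" "g ` S \<subseteq> T" "Ck_on k S g" "Ck_on (Suc k) T f"
  shows "Ck_on k S (\<lambda>x. frechet_derivative f (at (g x)) i)"
  using Ck_on_compose[OF assms(1-4) Ck_on_frechet_derivative[OF assms(5)]] .

lemma Ck_on_blinfun_apply_derivative: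
  assumes "Ck_on (Suc k) S f" "x \<in> S"
  shows "blinfun_apply (Blinfun (frechet_derivative f (at x))) = frechet_derivative f (at x)"
  using has_derivative_bounded_linear[OF Ck_on_has_derivativeD[OF assms]]
  by (rule bounded_linear_Blinfun_apply)

text \<open>In finite dimension, continuity along every basis vector is continuity in the operator
  norm. This is the form of C1 that the inverse function theorem and the compactness arguments below
  use.\<close>

lemma Ck_on_continuous_derivative:
  assumes "Ck_on (Suc k) S f"
  shows "continuous_on S (\<lambda>x. Blinfun (frechet_derivative f (at x)))"
proof (rule continuous_on_blinfun_componentwise)
  fix i :: 'a
  have "continuous_on S (\<lambda>x. frechet_derivative f (at x) i)"
    by (rule Ck_on_imp_continuous_on[OF Ck_on_frechet_derivative[OF assms]])
  then show "continuous_on S (\<lambda>x. blinfun_apply (Blinfun (frechet_derivative f (at x))) i)"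
    by (rule continuous_on_eq) (simp add: Ck_on_blinfun_apply_derivative[OF assms])
qed

text \<open>The inverse function theorem supplies a differentiable \<open>g\<close>; its smoothness
  is bootstrapped. With \<open>P\<close> a left inverse of the derivative at \<open>x0\<close>, the
  identity \<open>f'(g y) (g' y v) = v\<close> becomes
  \<open>g' y v = P v + (id - P f'(g y)) (g' y v)\<close>. On \<open>S'\<close> the operator
  \<open>id - P f'\<close> has norm below 1/2, so this is a linear fixed point equation whose
  coefficients are as regular as \<open>g\<close>.\<close>

lemma smooth_local_inverse:
  fixes f :: "'a::euclidean_space \<Rightarrow> 'a"
  assumes S: "open S" "x0 \<in> S" and f: "smooth_on S f"
    and inj: "\<And>v. frechet_derivative f (at x0) v = 0 \<Longrightarrow> v = 0"
  obtains U V g where "open U" "x0 \<in> U" "U \<subseteq> S" "open V" "homeomorphism U V f g" "smooth_on V g"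
proof -
  have Ck: "Ck_on k S f" for k
    using f by (simp add: smooth_on_def)
  note D = Ck_on_has_derivativeD[OF Ck]
  let ?D = "\<lambda>x. frechet_derivative f (at x)"
  define f' where "f' x = Blinfun (?D x)" for x
  have f': "blinfun_apply (f' x) = ?D x" if "x \<in> S" for x
    unfolding f'_def by (rule Ck_on_blinfun_apply_derivative[OF Ck that])
  have "linear (?D x0)"
    using D[OF S(2)] by (rule has_derivative_linear)
  moreover from this have "inj (?D x0)"
    using inj by (simp add: linear_injective_0)
  ultimately obtain P0 where P0: "linear P0" "P0 \<circ> ?D x0 = id"
    using linear_injective_left_inverse by blast
  define P where "P = Blinfun P0"
  have P: "blinfun_apply P = P0"
    using P0(1) by (simp add: P_def bounded_linear_Blinfun_apply linear_conv_bounded_linear)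
  have P_inv: "P o\<^sub>L f' x0 = id_blinfun"
    using P0(2) by (intro blinfun_eqI) (simp add: P f'[OF S(2)] fun_eq_iff)
  have contf': "continuous_on S f'"
    unfolding f'_def by (rule Ck_on_continuous_derivative[OF Ck])
  define S' where "S' = {x \<in> S. norm (id_blinfun - (P o\<^sub>L f' x)) < 1/2}"
  have "continuous_on S (\<lambda>x. norm (id_blinfun - (P o\<^sub>L f' x)))"
    using contf' by (intro continuous_intros)
  then have "open S'"
    using continuous_on_open_vimage[OF S(1)] open_lessThan[of "1/2"] S(1)
    unfolding S'_def by (smt (verit) Collect_cong Int_def lessThan_iff mem_Collect_eq vimage_eq)
  have "x0 \<in> S'"
    using S(2) by (simp add: S'_def P_inv)
  have derf: "(f has_derivative blinfun_apply (f' x)) (at x)" if "x \<in> S'" for x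
    using that D[of x] f'[of x] by (simp add: S'_def)
  have "continuous_on S' f'"
    by (rule continuous_on_subset[OF contf']) (auto simp: S'_def)
  obtain U V g g' where U: "open U" "U \<subseteq> S'" "x0 \<in> U" "open V" "f x0 \<in> V" "homeomorphism U V f g"
    and g: "\<And>y. y \<in> V \<Longrightarrow> (g has_derivative (g' y)) (at y)"
    "\<And>y. y \<in> V \<Longrightarrow> g' y = inv (blinfun_apply (f'(g y)))"
    "\<And>y. y \<in> V \<Longrightarrow> bij (blinfun_apply (f'(g y)))"
    using inverse_function_theorem[OF \<open>open S'\<close> derf \<open>continuous_on S' f'\<close> \<open>x0 \<in> S'\<close> P_inv]
    by metis
  have gU: "g y \<in> U" "g y \<in> S" "g y \<in> S'" if "y \<in> V" for y
    using that U(2,6) by (auto simp: homeomorphism_def S'_def)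
  have "Ck_on k V g" for k
  proof (induction k)
    case 0
    then show ?case using U(6) by (simp add: homeomorphism_def)
  next
    case (Suc k)
    show ?case
    proof (rule Ck_on_has_derivativeI[OF U(4) g(1)])
      fix v
      \<comment> \<open>The column \<open>i\<close> of \<open>id - P f'(g y)\<close>. It is of class
        k by the induction hypothesis on \<open>g\<close>, since \<open>f\<close> is smooth.\<close>
      let ?m = "\<lambda>i y. i - P (?D (g y) i)"
      have expand: "(\<Sum>i\<in>Basis. (u \<bullet> i) *\<^sub>R ?m i y) = u - P (?D (g y) u)" if "y \<in> V" for y u
      proof -
        have "bounded_linear (\<lambda>u. u - P (?D (g y) u))"
          by (intro bounded_linear_sub bounded_linear_ident bounded_linear_compose[OF blinfun.bounded_linear_right]
            has_derivative_bounded_linear[OF D[OF gU(2)[OF that]]])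
        from bounded_linear_euclidean_expansion[OF this, of u] show ?thesis by simp
      qed
      show "Ck_on k V (\<lambda>y. g' y v)"
      proof (rule Ck_on_linear_fixed_point[OF U(4), where J = Basis and m = ?m
            and w = "\<lambda>_. P v" and p = "\<lambda>i m u. (u \<bullet> i) *\<^sub>R m"])
        show "bounded_bilinear (\<lambda>m u. (u \<bullet> i) *\<^sub>R m)" for i :: 'a
          by (rule bounded_bilinear.flip, rule bounded_bilinear.comp1[OF bounded_bilinear_scaleR])
            (rule bounded_linear_inner_left)
        show "Ck_on k V (?m i)" for i
          using gU(2)
          by (intro Ck_on_diff Ck_on_const Ck_on_bounded_linear[OF _ blinfun.bounded_linear_right]
              Ck_on_frechet_derivative_compose[OF _ S(1) _ Suc Ck] U(4)) auto
        show "Ck_on k V (\<lambda>_. P v)"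
          by (rule Ck_on_const)
        show "g' y v = P v + (\<Sum>i\<in>Basis. (g' y v \<bullet> i) *\<^sub>R ?m i y)" if "y \<in> V" for y
        proof -
          have "?D (g y) (g' y v) = v"
            using g(2,3)[OF that] f'[OF gU(2)[OF that]] by (simp add: bij_is_surj surj_f_inv_f)
          then show ?thesis
            by (simp add: expand[OF that])
        qed
        show "norm (\<Sum>i\<in>Basis. (u \<bullet> i) *\<^sub>R ?m i y) \<le> norm u / 2" if "y \<in> V" for y u
        proof -
          have "norm (u - P (?D (g y) u)) = norm (blinfun_apply (id_blinfun - (P o\<^sub>L f' (g y))) u)"
            by (simp add: f'[OF gU(2)[OF that]] blinfun.diff_left)
          also have "\<dots> \<le> norm (id_blinfun - (P o\<^sub>L f' (g y))) * norm u"
            by (rule norm_blinfun)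
          also have "\<dots> \<le> 1/2 * norm u"
            using gU(3)[OF that] by (intro mult_right_mono) (auto simp: S'_def)
          finally show ?thesis
            by (simp add: expand[OF that])
        qed
      qed
    qed
  qed
  then have "smooth_on V g"
    by (simp add: smooth_on_def)
  moreover have "U \<subseteq> S"
    using U(2) by (auto simp: S'_def)
  ultimately show ?thesis
    using U that by blast
qed

section \<open>Estimates that are uniform on compact sets\<close>

lemma Ck_on_derivative_bounded_on_compact:
  assumes "Ck_on (Suc k) S f" "compact C" "C \<subseteq> S"
  obtains L where "L \<ge> 0" "\<And>x v. x \<in> C \<Longrightarrow> norm (frechet_derivative f (at x) v) \<le> L * norm v"
proof -
  let ?f' = "\<lambda>x. Blinfun (frechet_derivative f (at x))"
  have "bounded (?f' ` C)"
    by (intro compact_imp_bounded compact_continuous_image assms(2)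
        continuous_on_subset[OF Ck_on_continuous_derivative[OF assms(1)] assms(3)])
  then obtain L where L: "L > 0" "\<And>x. x \<in> C \<Longrightarrow> norm (?f' x) \<le> L"
    unfolding bounded_pos by auto
  have "norm (frechet_derivative f (at x) v) \<le> L * norm v" if "x \<in> C" for x v
  proof -
    have "norm (blinfun_apply (?f' x) v) \<le> norm (?f' x) * norm v"
      by (rule norm_blinfun)
    also have "\<dots> \<le> L * norm v"
      using L(2)[OF that] by (rule mult_right_mono) simp
    finally show ?thesis
      using assms(3) that by (simp add: Ck_on_blinfun_apply_derivative[OF assms(1)] subset_iff)
  qed
  with L(1) that[of L] show ?thesis by auto
qed

text \<open>The derivative is uniformly continuous on \<open>C\<close>, and by convexity the segment
  from \<open>x\<close> to \<open>y\<close> stays in \<open>C\<close>; the mean value inequality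
  then yields one \<open>d\<close> for all base points. This uniformity makes a pointwise
  linearization valid in the sup norm on paths.\<close>

lemma uniform_linearization_on_compact:
  assumes f: "Ck_on (Suc k) S f" and C: "compact C" "convex C" "C \<subseteq> S" and "e > 0"
  obtains d where "d > 0" "\<And>x y. x \<in> C \<Longrightarrow> y \<in> C \<Longrightarrow> norm (y - x) < d \<Longrightarrow>
    norm (f y - f x - frechet_derivative f (at x) (y - x)) \<le> e * norm (y - x)"
proof -
  let ?D = "\<lambda>x. frechet_derivative f (at x)"
  let ?f' = "\<lambda>x. Blinfun (?D x)"
  have "uniformly_continuous_on C ?f'"
    by (intro compact_uniformly_continuous C
        continuous_on_subset[OF Ck_on_continuous_derivative[OF f] C(3)])
  then obtain d where d: "d > 0" "\<And>x y. x \<in> C \<Longrightarrow> y \<in> C \<Longrightarrow> dist y x < d \<Longrightarrow> dist (?f' y) (?f' x) < e"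
    using \<open>e > 0\<close> unfolding uniformly_continuous_on_def by metis
  have "norm (f y - f x - ?D x (y - x)) \<le> e * norm (y - x)"
    if x: "x \<in> C" and y: "y \<in> C" and xy: "norm (y - x) < d" for x y
  proof -
    have sub: "closed_segment x y \<subseteq> C"
      using C(2) x y by (rule closed_segment_subset[rotated 2])
    have "norm (f y - f x - ?D x (y - x)) \<le> norm (y - x) * e"
    proof (rule differentiable_bound_linearization[where f' = ?D and S = "closed_segment x y"])
      show "x + t *\<^sub>R (y - x) \<in> closed_segment x y" if "t \<in> {0..1}" for t
        using that unfolding in_segment by (intro exI[of _ t]) (simp add: algebra_simps)
      show "(f has_derivative ?D z) (at z within closed_segment x y)" if "z \<in> closed_segment x y" for z
        using that sub C(3) by (auto intro!: has_derivative_at_withinI[OF Ck_on_has_derivativeD[OF f]])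
      show "onorm (?D z - ?D x) \<le> e" if z: "z \<in> closed_segment x y" for z
      proof -
        have "dist z x \<le> dist y x"
          using segment_bound(1)[OF z] by (simp add: dist_norm norm_minus_commute)
        then have "dist (?f' z) (?f' x) < e"
          using xy z sub x by (intro d) (auto simp: dist_norm)
        moreover have "?D z - ?D x = blinfun_apply (?f' z - ?f' x)"
          using z sub x C(3)
          by (auto simp: blinfun.diff_left Ck_on_blinfun_apply_derivative[OF f] subset_iff fun_eq_iff)
        ultimately show ?thesis
          by (simp add: dist_norm norm_blinfun.rep_eq)
      qed
    qed simp
    then show ?thesis by (simp add: mult.commute)
  qed
  with d(1) that show ?thesis by blast
qed

subsection \<open>Operators on bounded continuous paths\<close>

instance bcontfun :: (metric_space, banach) banach ..

text \<open>Paths are functions on the whole line although only the unit interval matters. Freezing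
  time outside it keeps the integral bounded, and the unit length gives operator norm at most
  1.\<close>

definition primitive :: "(real \<Rightarrow>\<^sub>C 'a::euclidean_space) \<Rightarrow> (real \<Rightarrow>\<^sub>C 'a)" where
  "primitive f = Bcontfun (\<lambda>t. integral {0..clamp 0 1 t} (apply_bcontfun f))"

lemma clamp_unit_interval: "clamp 0 1 (t::real) \<in> {0..1}"
  using clamp_in_interval[of 0 1 t] by simp

lemma norm_integral_bcontfun:
  fixes f :: "real \<Rightarrow>\<^sub>C 'a::euclidean_space"
  assumes "s \<in> {0..1}"
  shows "norm (integral {0..s} (apply_bcontfun f)) \<le> norm f"
proof -
  have "norm (integral {0..s} (apply_bcontfun f)) \<le> norm f * (s - 0)"
    using assms by (intro integral_bound norm_bounded) auto
  also have "\<dots> \<le> norm f * 1"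
    using assms by (intro mult_left_mono) auto
  finally show ?thesis by simp
qed

lemma primitive_apply:
  "apply_bcontfun (primitive f) t = integral {0..clamp 0 1 t} (apply_bcontfun f)"
proof -
  have "continuous_on UNIV (\<lambda>t. integral {0..clamp 0 1 t} (apply_bcontfun f))"
    by (rule clamp_continuous_on[where f = "\<lambda>s. integral {0..s} (apply_bcontfun f)"])
      (simp add: indefinite_integral_continuous_1 integrable_continuous_real)
  then have "(\<lambda>t. integral {0..clamp 0 1 t} (apply_bcontfun f)) \<in> bcontfun"
    by (rule bcontfun_normI) (rule norm_integral_bcontfun[OF clamp_unit_interval])
  then show ?thesis
    by (simp add: primitive_def Bcontfun_inverse)
qed

lemma norm_primitive_le: "norm (primitive f) \<le> norm f"
  by (rule norm_bound) (simp add: primitive_apply norm_integral_bcontfun[OF clamp_unit_interval])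

lemma bounded_linear_primitive: "bounded_linear primitive"
proof (rule bounded_linear_intro)
  have int: "apply_bcontfun f integrable_on {0..s}" for f :: "real \<Rightarrow>\<^sub>C 'a" and s
    by (intro integrable_continuous_real) simp
  show "primitive (f + g) = primitive f + primitive g" for f g :: "real \<Rightarrow>\<^sub>C 'a"
    by (rule bcontfun_eqI) (simp add: primitive_apply integral_add int)
  show "primitive (r *\<^sub>R f) = r *\<^sub>R primitive f" for r and f :: "real \<Rightarrow>\<^sub>C 'a"
    by (rule bcontfun_eqI) (simp add: primitive_apply)
  show "norm (primitive f) \<le> norm f * 1" for f :: "real \<Rightarrow>\<^sub>C 'a"
    by (simp add: norm_primitive_le)
qed

text \<open>Sums of these products over \<open>Basis\<close> express
  \<open>t \<mapsto> DY(\<phi> t)(\<psi> t)\<close> through finitely many bounded bilinear maps, the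
  shape that \<open>Ck_on_linear_fixed_point\<close> asks for.\<close>

definition component_mult :: "'a \<Rightarrow> (real \<Rightarrow>\<^sub>C 'b) \<Rightarrow> (real \<Rightarrow>\<^sub>C 'a::euclidean_space) \<Rightarrow> (real \<Rightarrow>\<^sub>C 'b::real_normed_vector)"
  where "component_mult i g \<psi> = Bcontfun (\<lambda>t. (apply_bcontfun \<psi> t \<bullet> i) *\<^sub>R apply_bcontfun g t)"

lemma norm_component_mult_pointwise:
  "norm ((apply_bcontfun \<psi> t \<bullet> i) *\<^sub>R apply_bcontfun g t) \<le> norm g * norm \<psi> * norm i"
proof -
  have "\<bar>apply_bcontfun \<psi> t \<bullet> i\<bar> \<le> norm \<psi> * norm i"
    using Cauchy_Schwarz_ineq2 norm_bounded[of \<psi> t] by (meson mult_right_mono norm_ge_zero order_trans)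
  then have "\<bar>apply_bcontfun \<psi> t \<bullet> i\<bar> * norm (apply_bcontfun g t) \<le> (norm \<psi> * norm i) * norm g"
    by (intro mult_mono norm_bounded) auto
  then show ?thesis by (simp add: algebra_simps)
qed

lemma component_mult_apply:
  "apply_bcontfun (component_mult i g \<psi>) t = (apply_bcontfun \<psi> t \<bullet> i) *\<^sub>R apply_bcontfun g t"
proof -
  have "(\<lambda>t. (apply_bcontfun \<psi> t \<bullet> i) *\<^sub>R apply_bcontfun g t) \<in> bcontfun"
    by (rule bcontfun_normI[OF _ norm_component_mult_pointwise]) (intro continuous_intros, simp_all)
  then show ?thesis
    by (simp add: component_mult_def Bcontfun_inverse)
qed

lemma bounded_bilinear_component_mult: "bounded_bilinear (component_mult i)"
proof
  show "\<exists>K. \<forall>g \<psi>. norm (component_mult i g \<psi>) \<le> norm g * norm \<psi> * K"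
    by (intro exI[of _ "norm i"] allI norm_bound) (simp only: component_mult_apply norm_component_mult_pointwise)
qed (rule bcontfun_eqI, simp add: component_mult_apply algebra_simps inner_add_left scaleR_left_distrib scaleR_right_distrib)+

text \<open>Clamping to a box makes the superposition operator total; it acts as \<open>\<phi> \<mapsto> Y \<circ> \<phi>\<close> on paths
  inside the box.\<close>

definition nemytskii :: "'a \<Rightarrow> 'a \<Rightarrow> ('a \<Rightarrow> 'b) \<Rightarrow> (real \<Rightarrow>\<^sub>C 'a::euclidean_space) \<Rightarrow> (real \<Rightarrow>\<^sub>C 'b::real_normed_vector)"
  where "nemytskii a b Y \<phi> = Bcontfun (\<lambda>t. Y (clamp a b (apply_bcontfun \<phi> t)))"

text \<open>Clamping is not differentiable at the faces of a box, so the superposition operator is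
  differentiated only within such a set.\<close>

definition paths_in :: "'a::euclidean_space set \<Rightarrow> (real \<Rightarrow>\<^sub>C 'a) set" where
  "paths_in C = {\<phi>. \<forall>t. apply_bcontfun \<phi> t \<in> C}"

lemma nemytskii_apply:
  assumes "continuous_on (cbox a b) Y"
  shows "apply_bcontfun (nemytskii a b Y \<phi>) t = Y (clamp a b (apply_bcontfun \<phi> t))"
proof -
  have "continuous_on UNIV (\<lambda>x. Y (clamp a b x))"
    by (rule clamp_continuous_on[OF assms])
  then have "continuous_on UNIV (\<lambda>t. Y (clamp a b (apply_bcontfun \<phi> t)))"
    by (rule continuous_on_compose2) auto
  moreover have "bounded (range (\<lambda>x. Y (clamp a b x)))"
    by (intro clamp_bounded compact_imp_bounded compact_continuous_image assms compact_cbox)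
  then have "bounded (range (\<lambda>t. Y (clamp a b (apply_bcontfun \<phi> t))))"
    by (rule bounded_subset) auto
  ultimately have "(\<lambda>t. Y (clamp a b (apply_bcontfun \<phi> t))) \<in> bcontfun"
    by (simp add: bcontfun_def)
  then show ?thesis
    by (simp add: nemytskii_def Bcontfun_inverse)
qed

lemma nemytskii_apply_paths_in:
  assumes "continuous_on (cbox a b) Y" "\<phi> \<in> paths_in (cbox a b)"
  shows "apply_bcontfun (nemytskii a b Y \<phi>) t = Y (apply_bcontfun \<phi> t)"
  using assms by (simp add: nemytskii_apply paths_in_def)

text \<open>Uniform continuity of \<open>Y\<close> on the compact box turns sup-closeness of paths
  into sup-closeness of their images. The bound \<open>e/2\<close> is used because a supremum of
  strict inequalities is only a weak one.\<close>

lemma continuous_on_nemytskii: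
  assumes Y: "continuous_on (cbox a b) Y" and ab: "cbox a b \<noteq> {}"
  shows "continuous_on T (nemytskii a b Y)"
  unfolding continuous_on_iff
proof (intro ballI allI impI)
  fix \<phi> and e :: real assume "e > 0"
  have "uniformly_continuous_on (cbox a b) Y"
    by (rule compact_uniformly_continuous[OF Y compact_cbox])
  then obtain d where d: "d > 0" "\<And>x y. x \<in> cbox a b \<Longrightarrow> y \<in> cbox a b \<Longrightarrow> dist y x < d \<Longrightarrow> dist (Y y) (Y x) < e/2"
    using \<open>e > 0\<close> unfolding uniformly_continuous_on_def by (metis half_gt_zero)
  have in_box: "clamp a b x \<in> cbox a b" for x
    using ab by (intro clamp_in_interval) (auto simp: box_ne_empty)
  have "dist (nemytskii a b Y \<psi>) (nemytskii a b Y \<phi>) < e" if "dist \<psi> \<phi> < d" for \<psi>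
  proof -
    have "dist (nemytskii a b Y \<psi>) (nemytskii a b Y \<phi>) \<le> e/2"
    proof (rule dist_bound)
      fix t
      have "dist (clamp a b (apply_bcontfun \<psi> t)) (clamp a b (apply_bcontfun \<phi> t)) < d"
        using dist_clamps_le_dist_args dist_bounded[of \<psi> t \<phi>] that by (meson le_less_trans)
      then show "dist (apply_bcontfun (nemytskii a b Y \<psi>) t) (apply_bcontfun (nemytskii a b Y \<phi>) t) \<le> e/2"
        using d(2)[OF in_box in_box] by (simp add: nemytskii_apply[OF Y] less_imp_le)
    qed
    then show ?thesis using \<open>e > 0\<close> by simp
  qed
  then show "\<exists>d>0. \<forall>x'\<in>T. dist x' \<phi> < d \<longrightarrow> dist (nemytskii a b Y x') (nemytskii a b Y \<phi>) < e"
    using d(1) by blast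
qed

text \<open>Written in coordinates so that the coefficients are again superposition operators,
  namely those of the partial derivatives of \<open>Y\<close>. This is what lets an induction on the
  order, with \<open>Y\<close> arbitrary, close.\<close>

definition nemytskii_derivative ::
    "'a \<Rightarrow> 'a \<Rightarrow> ('a \<Rightarrow> 'b) \<Rightarrow> (real \<Rightarrow>\<^sub>C 'a::euclidean_space) \<Rightarrow> (real \<Rightarrow>\<^sub>C 'a) \<Rightarrow> (real \<Rightarrow>\<^sub>C 'b::real_normed_vector)"
  where "nemytskii_derivative a b Y \<phi> \<psi> =
    (\<Sum>i\<in>Basis. component_mult i (nemytskii a b (\<lambda>x. frechet_derivative Y (at x) i) \<phi>) \<psi>)"

lemma bounded_linear_nemytskii_derivative: "bounded_linear (nemytskii_derivative a b Y \<phi>)"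
  unfolding nemytskii_derivative_def
  by (intro bounded_linear_sum bounded_bilinear.bounded_linear_right[OF bounded_bilinear_component_mult])

lemma apply_bcontfun_sum: "apply_bcontfun (\<Sum>i\<in>J. f i) t = (\<Sum>i\<in>J. apply_bcontfun (f i) t)"
  by (induction J rule: infinite_finite_induct) auto

lemma nemytskii_derivative_apply:
  assumes Y: "Ck_on (Suc k) S Y" and ab: "cbox a b \<subseteq> S" and \<phi>: "\<phi> \<in> paths_in (cbox a b)"
  shows "apply_bcontfun (nemytskii_derivative a b Y \<phi> \<psi>) t =
    frechet_derivative Y (at (apply_bcontfun \<phi> t)) (apply_bcontfun \<psi> t)"
proof -
  have "continuous_on (cbox a b) (\<lambda>x. frechet_derivative Y (at x) i)" for i
    by (rule continuous_on_subset[OF Ck_on_imp_continuous_on[OF Ck_on_frechet_derivative[OF Y]] ab])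
  moreover have "apply_bcontfun \<phi> t \<in> S"
    using ab \<phi> by (auto simp: paths_in_def)
  ultimately show ?thesis
    unfolding Ck_on_expansion[OF Y \<open>apply_bcontfun \<phi> t \<in> S\<close>, of "apply_bcontfun \<psi> t"]
    by (simp add: nemytskii_derivative_def apply_bcontfun_sum component_mult_apply
        nemytskii_apply_paths_in[OF _ \<phi>])
qed

text \<open>It is enough to linearize \<open>Y\<close> at each time separately: the modulus from
  \<open>uniform_linearization_on_compact\<close> does not depend on the point of the box, so the
  estimate passes to the sup norm.\<close>

lemma nemytskii_has_derivative:
  assumes Y: "Ck_on (Suc k) S Y" and ab: "cbox a b \<subseteq> S" and \<phi>: "\<phi> \<in> paths_in (cbox a b)"
  shows "(nemytskii a b Y has_derivative nemytskii_derivative a b Y \<phi>) (at \<phi> within paths_in (cbox a b))"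
  unfolding has_derivative_within_alt
proof (intro conjI allI impI)
  have contY: "continuous_on (cbox a b) Y"
    by (rule continuous_on_subset[OF Ck_on_imp_continuous_on[OF Y] ab])
  fix e :: real assume "e > 0"
  obtain d where d: "d > 0" "\<And>x y. x \<in> cbox a b \<Longrightarrow> y \<in> cbox a b \<Longrightarrow> norm (y - x) < d \<Longrightarrow>
    norm (Y y - Y x - frechet_derivative Y (at x) (y - x)) \<le> e * norm (y - x)"
    using uniform_linearization_on_compact[OF Y compact_cbox convex_box(1) ab \<open>e > 0\<close>] by blast
  show "\<exists>d>0. \<forall>\<psi>\<in>paths_in (cbox a b). norm (\<psi> - \<phi>) < d \<longrightarrow>
      norm (nemytskii a b Y \<psi> - nemytskii a b Y \<phi> - nemytskii_derivative a b Y \<phi> (\<psi> - \<phi>)) \<le> e * norm (\<psi> - \<phi>)"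
  proof (intro exI[of _ d] conjI ballI impI d(1) norm_bound)
    fix \<psi> t assume \<psi>: "\<psi> \<in> paths_in (cbox a b)" and close: "norm (\<psi> - \<phi>) < d"
    let ?x = "apply_bcontfun \<phi> t" and ?y = "apply_bcontfun \<psi> t"
    have le: "norm (?y - ?x) \<le> norm (\<psi> - \<phi>)"
      using norm_bounded[of "\<psi> - \<phi>" t] by simp
    have "norm (Y ?y - Y ?x - frechet_derivative Y (at ?x) (?y - ?x)) \<le> e * norm (?y - ?x)"
      using \<phi> \<psi> le close by (intro d(2)) (auto simp: paths_in_def)
    also have "\<dots> \<le> e * norm (\<psi> - \<phi>)"
      using le \<open>e > 0\<close> by simp
    finally show "norm (apply_bcontfun (nemytskii a b Y \<psi> - nemytskii a b Y \<phi> -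
        nemytskii_derivative a b Y \<phi> (\<psi> - \<phi>)) t) \<le> e * norm (\<psi> - \<phi>)"
      by (simp add: nemytskii_apply_paths_in[OF contY] \<phi> \<psi> nemytskii_derivative_apply[OF Y ab \<phi>])
  qed
qed (rule bounded_linear_nemytskii_derivative)

text \<open>By the chain rule the derivative is a sum of products of the derivative of
  \<open>\<phi>\<close> with superpositions of partial derivatives of \<open>Y\<close>, to which the
  induction hypothesis applies. Since \<open>\<phi>\<close> takes values in \<open>paths_in\<close>,
  the derivative within that set suffices.\<close>

lemma Ck_on_nemytskii:
  fixes \<phi> :: "'l::euclidean_space \<Rightarrow> (real \<Rightarrow>\<^sub>C 'a::euclidean_space)"
    and Y :: "'a \<Rightarrow> 'b::real_normed_vector"
  assumes S: "open S" and ab: "cbox a b \<subseteq> T" "cbox a b \<noteq> {}"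
    and \<phi>: "\<And>x. x \<in> S \<Longrightarrow> \<phi> x \<in> paths_in (cbox a b)"
    and "Ck_on k S \<phi>" "Ck_on k T Y"
  shows "Ck_on k S (\<lambda>x. nemytskii a b Y (\<phi> x))"
  using assms(5,6)
proof (induction k arbitrary: Y)
  case 0
  then have "continuous_on (cbox a b) Y"
    using ab(1) by (auto intro: continuous_on_subset)
  note nem = continuous_on_nemytskii[OF this ab(2), of UNIV]
  show ?case
    using 0 by (auto intro: continuous_on_compose2[OF nem])
next
  case (Suc k)
  let ?D = "\<lambda>x v. nemytskii_derivative a b Y (\<phi> x) (frechet_derivative \<phi> (at x) v)"
  show ?case
  proof (rule Ck_on_has_derivativeI[OF S])
    fix x assume x: "x \<in> S"
    have "(\<phi> has_derivative frechet_derivative \<phi> (at x)) (at x within S)"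
      using Ck_on_has_derivativeD[OF Suc.prems(1) x] by (rule has_derivative_at_withinI)
    moreover have "(nemytskii a b Y has_derivative nemytskii_derivative a b Y (\<phi> x)) (at (\<phi> x) within \<phi> ` S)"
      by (rule has_derivative_subset[OF nemytskii_has_derivative[OF Suc.prems(2) ab(1) \<phi>[OF x]]])
        (use \<phi> in auto)
    ultimately have "((\<lambda>x. nemytskii a b Y (\<phi> x)) has_derivative ?D x) (at x within S)"
      by (rule has_derivative_in_compose)
    then show "((\<lambda>x. nemytskii a b Y (\<phi> x)) has_derivative ?D x) (at x)"
      by (simp only: at_within_open[OF x S])
  next
    fix v
    show "Ck_on k S (\<lambda>x. ?D x v)"
      unfolding nemytskii_derivative_def
    proof (intro Ck_on_sum Ck_on_bilinear[OF _ bounded_bilinear_component_mult] S)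
      show "Ck_on k S (\<lambda>x. nemytskii a b (\<lambda>x. frechet_derivative Y (at x) i) (\<phi> x))" for i
        by (rule Suc.IH[OF Ck_on_SucD[OF Suc.prems(1)] Ck_on_frechet_derivative[OF Suc.prems(2)]])
      show "Ck_on k S (\<lambda>x. frechet_derivative \<phi> (at x) v)"
        by (rule Ck_on_frechet_derivative[OF Suc.prems(1)])
    qed
  qed
qed

lemma bounded_linear_const_bcontfun:
  "bounded_linear (const_bcontfun :: 'a::real_normed_vector \<Rightarrow> ('b::topological_space \<Rightarrow>\<^sub>C 'a))"
  by (rule bounded_linear_intro[where K = 1]) (auto intro: bcontfun_eqI norm_bound)

lemma bounded_linear_apply_bcontfun:
  "bounded_linear (\<lambda>\<phi> :: 'b::topological_space \<Rightarrow>\<^sub>C 'a::real_normed_vector. apply_bcontfun \<phi> t)"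
  by (rule bounded_linear_intro[where K = 1]) (auto intro: norm_bounded)

lemma bounded_bilinear_linear_compose:
  assumes "bounded_linear L" "bounded_bilinear p"
  shows "bounded_bilinear (\<lambda>x y. L (p x y))"
proof -
  interpret L: bounded_linear L by fact
  interpret p: bounded_bilinear p by fact
  obtain K where K: "K > 0" "\<And>x. norm (L x) \<le> norm x * K"
    using L.pos_bounded by blast
  obtain M where M: "\<And>x y. norm (p x y) \<le> norm x * norm y * M"
    using p.bounded by blast
  show ?thesis
  proof
    have "norm (L (p x y)) \<le> norm x * norm y * (M * K)" for x y
      using order_trans[OF K(2)[of "p x y"] mult_right_mono[OF M[of x y], of K]] K(1)
      by (simp add: mult.assoc)
    then show "\<exists>K. \<forall>x y. norm (L (p x y)) \<le> norm x * norm y * K"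
      by blast
  qed (simp_all add: p.add_left p.add_right p.scaleR_left p.scaleR_right L.add L.scaleR)
qed

subsection \<open>The flow of a linear combination of fields\<close>

text \<open>The factor \<open>CARD('p)\<close> comes from estimating a combination of fields term by
  term. The bound 1/2 makes the Picard operator a half contraction. The radius
  \<open>\<epsilon>\<close> limits both the distance of the starting point from the centre and the
  displacement along a path, and two such steps stay in the box.\<close>

locale flow_box =
  fixes \<Omega> :: "'a::euclidean_space set" and a b x\<^sub>0 :: 'a
    and Y :: "'p::finite \<Rightarrow> 'a \<Rightarrow> 'a" and L C \<delta> \<epsilon> :: real
  assumes open_domain: "open \<Omega>" and box_subset: "cbox a b \<subseteq> \<Omega>"
    and smooth: "smooth_on \<Omega> (Y k)"
    and L_nonneg: "L \<ge> 0"
    and derivative_bound: "x \<in> cbox a b \<Longrightarrow> norm (frechet_derivative (Y k) (at x) v) \<le> L * norm v"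
    and field_bound: "x \<in> cbox a b \<Longrightarrow> norm (Y k x) \<le> C"
    and C_nonneg: "C \<ge> 0"
    and delta: "\<delta> > 0" "CARD('p) * (\<delta> * L) \<le> 1/2" "CARD('p) * (\<delta> * C) \<le> \<epsilon>"
    and eps: "\<epsilon> > 0" "x \<in> ball x\<^sub>0 \<epsilon> \<Longrightarrow> dist x y \<le> \<epsilon> \<Longrightarrow> y \<in> cbox a b"
begin

lemma Ck: "Ck_on m \<Omega> (Y k)"
  using smooth by (simp add: smooth_on_def)

lemma box_nonempty: "cbox a b \<noteq> {}"
  using eps(2)[of x\<^sub>0 x\<^sub>0] eps(1) by auto

lemma clamp_in_box: "clamp a b x \<in> cbox a b"
  using box_nonempty by (intro clamp_in_interval) (auto simp: box_ne_empty)

lemma continuous_on_field: "continuous_on (cbox a b) (Y k)"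
  by (rule continuous_on_subset[OF Ck_on_imp_continuous_on[OF Ck] box_subset])

abbreviation N where "N k \<equiv> nemytskii a b (Y k)"
abbreviation N' where "N' k \<equiv> nemytskii_derivative a b (Y k)"

definition params where "params = ball (0 :: real^'p) \<delta> \<times> ball x\<^sub>0 \<epsilon>"

lemma open_params: "open params"
  by (simp add: params_def open_Times)

lemma norm_combination_le:
  fixes f :: "'p \<Rightarrow> 'c::real_normed_vector" and u :: "real^'p"
  assumes "norm u < \<delta>" "\<And>k. norm (f k) \<le> B" "B \<ge> 0"
  shows "norm (\<Sum>k\<in>UNIV. (u $ k) *\<^sub>R f k) \<le> CARD('p) * (\<delta> * B)"
proof -
  have "norm (\<Sum>k\<in>UNIV. (u $ k) *\<^sub>R f k) \<le> (\<Sum>k\<in>(UNIV :: 'p set). \<delta> * B)"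
  proof (rule sum_norm_le)
    fix k
    have "\<bar>u $ k\<bar> * norm (f k) \<le> \<delta> * B"
      using component_le_norm_cart[of u k] assms delta(1) by (intro mult_mono) auto
    then show "norm ((u $ k) *\<^sub>R f k) \<le> \<delta> * B"
      by simp
  qed
  then show ?thesis by simp
qed

text \<open>Two facts combine: clamping does not increase distances, and the mean value inequality
  holds on the convex box.\<close>

lemma norm_nemytskii_diff_le: "norm (N k \<phi> - N k \<psi>) \<le> L * norm (\<phi> - \<psi>)"
proof (rule norm_bound)
  fix t
  let ?x = "clamp a b (apply_bcontfun \<phi> t)" and ?y = "clamp a b (apply_bcontfun \<psi> t)"
  have "norm (Y k ?x - Y k ?y) \<le> L * norm (?x - ?y)"
  proof (rule differentiable_bound[OF convex_box(1)])
    show "(Y k has_derivative frechet_derivative (Y k) (at x)) (at x within cbox a b)"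
      if "x \<in> cbox a b" for x
      using that box_subset by (auto intro!: has_derivative_at_withinI[OF Ck_on_has_derivativeD[OF Ck]])
    show "onorm (frechet_derivative (Y k) (at x)) \<le> L" if "x \<in> cbox a b" for x
      using derivative_bound[OF that] by (intro onorm_bound L_nonneg)
  qed (rule clamp_in_box)+
  also have "\<dots> \<le> L * norm (\<phi> - \<psi>)"
  proof (rule mult_left_mono[OF _ L_nonneg])
    show "norm (?x - ?y) \<le> norm (\<phi> - \<psi>)"
      using dist_clamps_le_dist_args dist_bounded[of \<phi> t \<psi>]
      unfolding dist_norm by (meson order_trans)
  qed
  finally show "norm (apply_bcontfun (N k \<phi> - N k \<psi>) t) \<le> L * norm (\<phi> - \<psi>)"
    by (simp add: nemytskii_apply[OF continuous_on_field])
qed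

text \<open>The integral equation of the flow: its solution \<open>\<phi> = picard ((u, \<eta>), \<phi>)\<close> is the integral curve
  of \<open>\<Sum>k. u\<^sub>k Y\<^sub>k\<close> issuing from \<open>\<eta>\<close> as long as it stays in the box.\<close>

definition picard :: "((real^'p) \<times> 'a) \<times> (real \<Rightarrow>\<^sub>C 'a) \<Rightarrow> (real \<Rightarrow>\<^sub>C 'a)" where
  "picard z = const_bcontfun (snd (fst z)) + primitive (\<Sum>k\<in>UNIV. (fst (fst z) $ k) *\<^sub>R N k (snd z))"

definition picard' where
  "picard' z h = const_bcontfun (snd (fst h)) + primitive (\<Sum>k\<in>UNIV.
    (fst (fst z) $ k) *\<^sub>R N' k (snd z) (snd h) + (fst (fst h) $ k) *\<^sub>R N k (snd z))"

text \<open>Determined by its equation when \<open>norm (fst z) < \<delta>\<close>, with no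
  restriction on the starting point.\<close>

definition path where "path z = (THE \<phi>. \<phi> = picard (z, \<phi>))"

definition flow where "flow z = apply_bcontfun (path z) 1"

lemma picard_half_contraction:
  assumes "norm (fst z) < \<delta>"
  shows "norm (picard (z, \<phi>) - picard (z, \<psi>)) \<le> norm (\<phi> - \<psi>) / 2"
proof -
  interpret primitive: bounded_linear "primitive :: (real \<Rightarrow>\<^sub>C 'a) \<Rightarrow> _"
    by (rule bounded_linear_primitive)
  have "picard (z, \<phi>) - picard (z, \<psi>) = primitive (\<Sum>k\<in>UNIV. (fst z $ k) *\<^sub>R (N k \<phi> - N k \<psi>))"
    by (simp add: picard_def primitive.diff[symmetric] sum_subtractf[symmetric] scaleR_diff_right)
  also have "norm \<dots> \<le> norm (\<Sum>k\<in>UNIV. (fst z $ k) *\<^sub>R (N k \<phi> - N k \<psi>))"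
    by (rule norm_primitive_le)
  also have "\<dots> \<le> CARD('p) * (\<delta> * (L * norm (\<phi> - \<psi>)))"
    using L_nonneg by (intro norm_combination_le assms norm_nemytskii_diff_le) simp
  also have "\<dots> = (CARD('p) * (\<delta> * L)) * norm (\<phi> - \<psi>)"
    by simp
  also have "\<dots> \<le> 1/2 * norm (\<phi> - \<psi>)"
    by (rule mult_right_mono[OF delta(2)]) simp
  finally show ?thesis by simp
qed

lemma path_ex1:
  assumes "norm (fst z) < \<delta>"
  shows "\<exists>!\<phi>. \<phi> = picard (z, \<phi>)"
proof -
  have "\<exists>!\<phi>. picard (z, \<phi>) = \<phi>"
    using picard_half_contraction[OF assms] by (intro banach_fix_type[of "1/2"]) (auto simp: dist_norm)
  then show ?thesis by (simp only: eq_commute)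
qed

lemma path_eq: "norm (fst z) < \<delta> \<Longrightarrow> path z = picard (z, path z)"
  unfolding path_def by (rule theI'[OF path_ex1])

lemma path_unique: "norm (fst z) < \<delta> \<Longrightarrow> \<phi> = picard (z, \<phi>) \<Longrightarrow> path z = \<phi>"
  using path_ex1 path_eq by blast

lemma picard_apply:
  "apply_bcontfun (picard (z, \<phi>)) t = snd z +
    integral {0..clamp 0 1 t} (\<lambda>s. \<Sum>k\<in>UNIV. (fst z $ k) *\<^sub>R Y k (clamp a b (apply_bcontfun \<phi> s)))"
proof -
  have "apply_bcontfun (\<Sum>k\<in>UNIV. (fst z $ k) *\<^sub>R N k \<phi>) =
      (\<lambda>s. \<Sum>k\<in>UNIV. (fst z $ k) *\<^sub>R Y k (clamp a b (apply_bcontfun \<phi> s)))"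
    by (simp add: fun_eq_iff apply_bcontfun_sum nemytskii_apply[OF continuous_on_field])
  then show ?thesis
    by (simp add: picard_def primitive_apply)
qed

text \<open>The clamped fields are bounded by \<open>C\<close> along any path whatsoever, so the
  displacement is at most \<open>\<epsilon>\<close> before it is known that the path avoids the
  clamp. Hence on \<open>params\<close> the clamped equation is the genuine one.\<close>

lemma path_in_box:
  assumes "z \<in> params"
  shows "path z \<in> paths_in (cbox a b)"
proof -
  have z: "norm (fst z) < \<delta>" "snd z \<in> ball x\<^sub>0 \<epsilon>"
    using assms by (auto simp: params_def)
  have "norm (\<Sum>k\<in>UNIV. (fst z $ k) *\<^sub>R N k (path z)) \<le> CARD('p) * (\<delta> * C)"
  proof (intro norm_combination_le z C_nonneg norm_bound)
    show "norm (apply_bcontfun (N k (path z)) t) \<le> C" for k t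
      by (simp add: nemytskii_apply[OF continuous_on_field] field_bound clamp_in_box)
  qed
  then have "norm (primitive (\<Sum>k\<in>UNIV. (fst z $ k) *\<^sub>R N k (path z))) \<le> \<epsilon>"
    using norm_primitive_le delta(3) by (meson order_trans)
  then have "norm (path z - const_bcontfun (snd z)) \<le> \<epsilon>"
    by (subst path_eq[OF z(1)]) (simp add: picard_def)
  then have "dist (snd z) (apply_bcontfun (path z) t) \<le> \<epsilon>" for t
    using norm_bounded[of "path z - const_bcontfun (snd z)" t] by (simp add: dist_norm norm_minus_commute)
  then show ?thesis
    using eps(2)[OF z(2)] by (simp add: paths_in_def)
qed

lemma continuous_on_path: "continuous_on params path"
proof (rule fixed_point_continuous_on[where F = picard])
  show "norm (picard (z, u) - picard (z, v)) \<le> norm (u - v) / 2" if "z \<in> params" for z u v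
    using that by (intro picard_half_contraction) (auto simp: params_def)
  show "path z = picard (z, path z)" if "z \<in> params" for z
    using that by (intro path_eq) (auto simp: params_def)
  show "continuous_on params (\<lambda>z. picard (z, v))" for v
    unfolding picard_def fst_conv snd_conv
    by (intro continuous_on_add bounded_linear.continuous_on[OF bounded_linear_const_bcontfun]
        bounded_linear.continuous_on[OF bounded_linear_primitive] continuous_on_sum continuous_intros)
qed

lemma picard_has_derivative:
  assumes "\<phi> \<in> paths_in (cbox a b)"
  shows "(picard has_derivative picard' (z, \<phi>)) (at (z, \<phi>) within T \<times> paths_in (cbox a b))"
proof -
  have N: "((\<lambda>z. N k (snd z)) has_derivative (\<lambda>h. N' k \<phi> (snd h))) (at (z, \<phi>) within T \<times> paths_in (cbox a b))" for k
  proof (rule has_derivative_in_compose[OF has_derivative_snd[OF has_derivative_ident]])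
    show "(N k has_derivative N' k \<phi>) (at (snd (z, \<phi>)) within snd ` (T \<times> paths_in (cbox a b)))"
      unfolding snd_conv
      by (rule has_derivative_subset[OF nemytskii_has_derivative[OF Ck box_subset assms]]) auto
  qed
  have lin: "bounded_linear (\<lambda>h :: ((real^'p) \<times> 'a) \<times> (real \<Rightarrow>\<^sub>C 'a). fst (fst h) $ k)" for k
    by (intro bounded_linear_compose[OF bounded_linear_vec_nth] bounded_linear_compose[OF bounded_linear_fst] bounded_linear_fst)
  have lin2: "bounded_linear (\<lambda>h :: ((real^'p) \<times> 'a) \<times> (real \<Rightarrow>\<^sub>C 'a). const_bcontfun (snd (fst h)) :: real \<Rightarrow>\<^sub>C 'a)"
    by (intro bounded_linear_compose[OF bounded_linear_const_bcontfun] bounded_linear_compose[OF bounded_linear_snd] bounded_linear_fst)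
  have "(picard has_derivative (\<lambda>h. const_bcontfun (snd (fst h)) + primitive (\<Sum>k\<in>UNIV.
    (fst (fst (z, \<phi>)) $ k) *\<^sub>R N' k \<phi> (snd h) + (fst (fst h) $ k) *\<^sub>R N k (snd (z, \<phi>))))) 
    (at (z, \<phi>) within T \<times> paths_in (cbox a b))"
    unfolding picard_def[abs_def]
    by (intro has_derivative_add bounded_linear_imp_has_derivative[OF lin2]
        bounded_linear.has_derivative[OF bounded_linear_primitive] has_derivative_sum
        bounded_bilinear.FDERIV[OF bounded_bilinear_scaleR bounded_linear_imp_has_derivative[OF lin] N])
  then show ?thesis
    by (simp add: picard'_def[abs_def])
qed

lemma norm_picard'_le:
  assumes "norm (fst z) < \<delta>" "\<phi> \<in> paths_in (cbox a b)"
  shows "norm (picard' (z, \<phi>) (0, \<psi>)) \<le> norm \<psi> / 2"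
proof -
  have "picard' (z, \<phi>) (0, \<psi>) = primitive (\<Sum>k\<in>UNIV. (fst z $ k) *\<^sub>R N' k \<phi> \<psi>)"
    by (simp add: picard'_def)
  also have "norm \<dots> \<le> norm (\<Sum>k\<in>UNIV. (fst z $ k) *\<^sub>R N' k \<phi> \<psi>)"
    by (rule norm_primitive_le)
  also have "\<dots> \<le> CARD('p) * (\<delta> * (L * norm \<psi>))"
  proof (intro norm_combination_le assms norm_bound)
    fix k t
    have "norm (apply_bcontfun (N' k \<phi> \<psi>) t) \<le> L * norm (apply_bcontfun \<psi> t)"
      using assms(2) unfolding nemytskii_derivative_apply[OF Ck box_subset assms(2)]
      by (intro derivative_bound) (simp add: paths_in_def)
    also have "\<dots> \<le> L * norm \<psi>"
      using L_nonneg by (intro mult_left_mono norm_bounded)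
    finally show "norm (apply_bcontfun (N' k \<phi> \<psi>) t) \<le> L * norm \<psi>" .
  qed (use L_nonneg in simp)
  also have "\<dots> = (CARD('p) * (\<delta> * L)) * norm \<psi>"
    by simp
  also have "\<dots> \<le> 1/2 * norm \<psi>"
    by (rule mult_right_mono[OF delta(2)]) simp
  finally show ?thesis by simp
qed

lemma path_has_derivative:
  assumes z: "z \<in> params"
  obtains D where "(path has_derivative D) (at z)" "\<And>h. D h = picard' (z, path z) (h, D h)"
proof -
  have path: "path w = picard (w, path w)" if "w \<in> params" for w
    using that by (intro path_eq) (auto simp: params_def)
  have cont: "continuous (at z) path"
    using continuous_on_path open_params z by (simp add: continuous_on_eq_continuous_at)
  have half: "norm (picard' (z, path z) (0, v)) \<le> norm v / 2" for v
    using z by (intro norm_picard'_le path_in_box) (auto simp: params_def)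
  show ?thesis
    by (rule fixed_point_has_derivative[where F = picard and S = params and Q = "paths_in (cbox a b)",
          OF picard_has_derivative[OF path_in_box[OF z]] open_params z path path_in_box cont half that])
qed

text \<open>The equation for \<open>D z h\<close> is linear in \<open>D z h\<close>, and the path
  enters its coefficients only through superpositions with smooth maps. If the path is of class m,
  so are the coefficients, hence so is \<open>D z h\<close>, which raises the class of the path by
  one.\<close>

lemma Ck_on_path: "Ck_on m params path"
proof (induction m)
  case 0
  show ?case using continuous_on_path by simp
next
  case (Suc m)
  have "\<forall>z\<in>params. \<exists>D. (path has_derivative D) (at z) \<and> (\<forall>h. D h = picard' (z, path z) (h, D h))"
    using path_has_derivative by metis
  then have "\<exists>D. \<forall>z\<in>params. (path has_derivative D z) (at z) \<and> (\<forall>h. D z h = picard' (z, path z) (h, D z h))"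
    by (rule bchoice)
  then obtain D where D: "\<And>z. z \<in> params \<Longrightarrow> (path has_derivative D z) (at z)"
    "\<And>z h. z \<in> params \<Longrightarrow> D z h = picard' (z, path z) (h, D z h)"
    by blast
  show ?case
  proof (rule Ck_on_has_derivativeI[OF open_params D(1)])
    fix h :: "(real^'p) \<times> 'a"
    \<comment> \<open>One bilinear map for each pair of a field and a coordinate: the integration
      goes into \<open>?p\<close>, the scalar parameter into the coefficient
      \<open>?m\<close>.\<close>
    let ?J = "(UNIV :: 'p set) \<times> (Basis :: 'a set)"
    let ?p = "\<lambda>(k :: 'p, i) g \<psi>. primitive (component_mult i g \<psi>) :: real \<Rightarrow>\<^sub>C 'a"
    let ?m = "\<lambda>(k, i) z. (fst z $ k) *\<^sub>R nemytskii a b (\<lambda>x. frechet_derivative (Y k) (at x) i) (path z)"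
    let ?w = "\<lambda>z. const_bcontfun (snd h) + primitive (\<Sum>k\<in>UNIV. (fst h $ k) *\<^sub>R N k (path z))"
    have "linear (primitive :: (real \<Rightarrow>\<^sub>C 'a) \<Rightarrow> _)"
      by (rule bounded_linear.linear[OF bounded_linear_primitive])
    note lin = linear_sum[OF this] linear_add[OF this] linear_scale[OF this]
      bounded_bilinear.scaleR_left[OF bounded_bilinear_component_mult]
    have sum_J: "(\<Sum>j\<in>?J. ?p j (?m j z) \<psi>) = primitive (\<Sum>k\<in>UNIV. (fst z $ k) *\<^sub>R N' k (path z) \<psi>)" for z \<psi>
    proof -
      have "(\<Sum>j\<in>?J. ?p j (?m j z) \<psi>) = (\<Sum>(k, i)\<in>?J. primitive (component_mult i
          ((fst z $ k) *\<^sub>R nemytskii a b (\<lambda>x. frechet_derivative (Y k) (at x) i) (path z)) \<psi>))"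
        by (rule sum.cong) auto
      then show ?thesis
        by (simp add: sum.cartesian_product[symmetric] nemytskii_derivative_def lin scaleR_sum_right)
    qed
    show "Ck_on m params (\<lambda>z. D z h)"
    proof (rule Ck_on_linear_fixed_point[OF open_params, where J = ?J and p = ?p and m = ?m and w = ?w])
      show "bounded_bilinear (?p j)" for j
        by (cases j) (auto intro: bounded_bilinear_linear_compose bounded_linear_primitive
            bounded_bilinear_component_mult)
      have nem: "Ck_on m params (\<lambda>z. nemytskii a b G (path z))" if "Ck_on m \<Omega> G" for G :: "'a \<Rightarrow> 'a"
        by (rule Ck_on_nemytskii[OF open_params box_subset box_nonempty path_in_box Suc that])
      have coord: "Ck_on m params (\<lambda>z. fst z $ k)" for k
        by (rule Ck_on_linear[OF open_params bounded_linear_compose[OF bounded_linear_vec_nth bounded_linear_fst]])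
      show "Ck_on m params (?m j)" for j
        by (cases j, simp only: prod.case)
          (rule Ck_on_bilinear[OF open_params bounded_bilinear_scaleR coord nem[OF Ck_on_frechet_derivative[OF Ck]]])
      show "Ck_on m params ?w"
        by (intro Ck_on_add Ck_on_const open_params Ck_on_bounded_linear[OF _ bounded_linear_primitive]
            Ck_on_sum Ck_on_bounded_linear[OF _ bounded_linear_scaleR_right] nem Ck)
      show "D z h = ?w z + (\<Sum>j\<in>?J. ?p j (?m j z) (D z h))" if "z \<in> params" for z
        unfolding sum_J by (rule trans[OF D(2)[OF that]]) (simp add: picard'_def lin sum.distrib)
      show "norm (\<Sum>j\<in>?J. ?p j (?m j z) v) \<le> norm v / 2" if "z \<in> params" for z v
        using norm_picard'_le[of z "path z" v] path_in_box[OF that] that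
        unfolding sum_J by (simp add: picard'_def params_def mem_Times_iff)
    qed
  qed
qed

lemma Ck_on_flow: "Ck_on m params flow"
  unfolding flow_def[abs_def]
  by (rule Ck_on_bounded_linear[OF open_params bounded_linear_apply_bcontfun Ck_on_path])

lemma path_zero: "path (0, x) = const_bcontfun x"
  by (rule path_unique)
    (simp_all add: delta(1) picard_def linear_0[OF bounded_linear.linear[OF bounded_linear_primitive]])

lemma flow_zero: "flow (0, x) = x"
  by (simp add: flow_def path_zero)

text \<open>At \<open>u = 0\<close> the path is constant and the term of \<open>picard'\<close> with
  the unknown derivative carries the factor 0, so the equation for \<open>D\<close> becomes an
  explicit formula.\<close>

lemma flow_has_derivative_at_zero:
  assumes "x \<in> ball x\<^sub>0 \<epsilon>"
  shows "(flow has_derivative (\<lambda>h. snd h + (\<Sum>k\<in>UNIV. (fst h $ k) *\<^sub>R Y k x))) (at (0, x))"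
proof -
  have z: "(0, x) \<in> params"
    using assms delta(1) by (simp add: params_def)
  obtain D where D: "(path has_derivative D) (at (0, x))" "\<And>h. D h = picard' ((0, x), path (0, x)) (h, D h)"
    using path_has_derivative[OF z] by blast
  have x: "x \<in> cbox a b"
    using eps(2)[OF assms, of x] eps(1) by simp
  have "apply_bcontfun (\<Sum>k\<in>UNIV. (fst h $ k) *\<^sub>R N k (const_bcontfun x)) = (\<lambda>t. \<Sum>k\<in>UNIV. (fst h $ k) *\<^sub>R Y k x)" for h :: "(real^'p) \<times> 'a"
    using x by (simp add: fun_eq_iff apply_bcontfun_sum nemytskii_apply[OF continuous_on_field])
  then have "apply_bcontfun (D h) 1 = snd h + (\<Sum>k\<in>UNIV. (fst h $ k) *\<^sub>R Y k x)" for h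
    by (subst D(2)) (simp add: picard'_def path_zero primitive_apply)
  with bounded_linear.has_derivative[OF bounded_linear_apply_bcontfun D(1), of 1] show ?thesis
    by (simp add: flow_def[abs_def])
qed

text \<open>For parameters in \<open>params\<close> both clamps disappear, time being in the unit
  interval and the path in the box; the fixed point equation is then the integrated differential
  equation.\<close>

lemma has_exp_flow:
  assumes "z \<in> params"
  shows "has_exp \<Omega> (\<lambda>x. \<Sum>k\<in>UNIV. (fst z $ k) *\<^sub>R Y k x) (snd z) (flow z)"
  unfolding has_exp_def
proof (intro exI[of _ "apply_bcontfun (path z)"] conjI ballI)
  let ?g = "\<lambda>s. \<Sum>k\<in>UNIV. (fst z $ k) *\<^sub>R Y k (apply_bcontfun (path z) s)"
  have z: "norm (fst z) < \<delta>"
    using assms by (auto simp: params_def)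
  have in_box: "apply_bcontfun (path z) t \<in> cbox a b" for t
    using path_in_box[OF assms] by (simp add: paths_in_def)
  have path: "apply_bcontfun (path z) t = snd z + integral {0..t} ?g" if "t \<in> {0..1}" for t
    using that by (subst path_eq[OF z]) (simp add: picard_apply in_box)
  show "apply_bcontfun (path z) 0 = snd z"
    by (simp add: path)
  show "apply_bcontfun (path z) 1 = flow z"
    by (simp add: flow_def)
  fix t :: real assume t: "t \<in> {0..1}"
  show "apply_bcontfun (path z) t \<in> \<Omega>"
    using in_box box_subset by blast
  have "continuous_on {0..1} ?g"
    by (intro continuous_intros continuous_on_compose2[OF continuous_on_field]) (auto simp: in_box)
  then have "((\<lambda>t. snd z + integral {0..t} ?g) has_vector_derivative 0 + ?g t) (at t within {0..1})"
    by (intro has_vector_derivative_add has_vector_derivative_const integral_has_vector_derivative t)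
  then show "(apply_bcontfun (path z) has_vector_derivative ?g t) (at t within {0..1})"
    using t by (intro has_vector_derivative_transform[OF t path]) simp_all
qed

text \<open>The path run backwards solves the Picard equation for \<open>- u\<close> from the
  endpoint, and fixed points are unique. Neither \<open>x\<close> nor the endpoint has to lie near
  the centre, because the clamped operator is a contraction for every starting point.\<close>

lemma flow_reverse:
  assumes "norm u < \<delta>"
  shows "flow (- u, flow (u, x)) = x"
proof -
  let ?\<phi> = "apply_bcontfun (path (u, x))"
  let ?g = "\<lambda>s. \<Sum>k\<in>UNIV. (u $ k) *\<^sub>R Y k (clamp a b (?\<phi> s))"
  have path: "?\<phi> t = x + integral {0..clamp 0 1 t} ?g" for t
    using assms by (subst path_eq) (simp_all add: picard_apply)
  have cont: "continuous_on T ?g" for T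
    by (intro continuous_intros continuous_on_compose2[OF clamp_continuous_on[OF continuous_on_field]]) auto
  \<comment> \<open>The clamp makes the reversed path constant outside the unit interval, as every
    value of \<open>picard\<close> is.\<close>
  have "continuous_on UNIV (\<lambda>t. ?\<phi> (1 - clamp 0 1 t))"
    by (rule clamp_continuous_on[where f = "\<lambda>s. ?\<phi> (1 - s)"])
      (intro continuous_on_compose2[OF continuous_on_apply_bcontfun] continuous_intros, auto)
  then have "(\<lambda>t. ?\<phi> (1 - clamp 0 1 t)) \<in> bcontfun"
    by (rule bcontfun_normI[OF _ norm_bounded])
  then obtain \<psi> where \<psi>: "apply_bcontfun \<psi> = (\<lambda>t. ?\<phi> (1 - clamp 0 1 t))"
    by (metis bcontfunE)
  have "path (- u, flow (u, x)) = \<psi>"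
  proof (rule path_unique)
    show "\<psi> = picard ((- u, flow (u, x)), \<psi>)"
    proof (rule bcontfun_eqI)
      fix t :: real
      define s where "s = clamp 0 1 t"
      have s: "s \<in> {0..1}"
        unfolding s_def by (rule clamp_unit_interval)
      have "integral {0..s} (\<lambda>r. \<Sum>k\<in>UNIV. (- u $ k) *\<^sub>R Y k (clamp a b (apply_bcontfun \<psi> r)))
          = integral {0..s} (\<lambda>r. - ?g (1 - r))"
        using s by (intro integral_cong) (simp add: \<psi> sum_negf)
      also have "\<dots> = - integral {0..s} (\<lambda>r. ?g (1 - r))"
        by simp
      also have "integral {0..s} (\<lambda>r. ?g (1 - r)) = integral {- s..0} (\<lambda>r. ?g (r + 1))"
        using Henstock_Kurzweil_Integration.integral_reflect_real[of 0 "-s" "\<lambda>r. ?g (r + 1)"]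
        by (simp add: uminus_add_conv_diff)
      also have "\<dots> = integral {1 - s..1} ?g"
        using integral_shift_real_ivl[of "1 - s" 1 1 ?g] by simp
      finally have rev: "apply_bcontfun (picard ((- u, flow (u, x)), \<psi>)) t = flow (u, x) - integral {1 - s..1} ?g"
        by (simp add: picard_apply s_def)
      have "integral {0..1 - s} ?g + integral {1 - s..1} ?g = integral {0..1} ?g"
        using s cont by (intro Henstock_Kurzweil_Integration.integral_combine integrable_continuous_real) auto
      moreover have "flow (u, x) = x + integral {0..1} ?g"
        using path[of 1] by (simp add: flow_def)
      moreover have "apply_bcontfun \<psi> t = x + integral {0..1 - s} ?g"
        using s path[of "1 - s"] by (simp add: \<psi> s_def[symmetric])
      ultimately show "apply_bcontfun \<psi> t = apply_bcontfun (picard ((- u, flow (u, x)), \<psi>)) t"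
        unfolding rev by (simp add: algebra_simps)
    qed
  qed (simp add: assms)
  then show ?thesis
    using path[of 0] by (simp add: flow_def \<psi>)
qed

end

lemma flow_box_exists:
  fixes Y :: "'p::finite \<Rightarrow> 'a::euclidean_space \<Rightarrow> 'a"
  assumes \<Omega>: "open \<Omega>" "x\<^sub>0 \<in> \<Omega>" and smooth: "\<And>k. smooth_on \<Omega> (Y k)"
  obtains a b L C \<delta> \<epsilon> where "flow_box \<Omega> a b x\<^sub>0 Y L C \<delta> \<epsilon>"
proof -
  have Ck: "Ck_on m \<Omega> (Y k)" for m k
    using smooth by (simp add: smooth_on_def)
  obtain a b where ab: "cbox a b \<subseteq> \<Omega>" "x\<^sub>0 \<in> box a b"
    using \<Omega> open_contains_cbox by metis
  obtain r where r: "r > 0" "ball x\<^sub>0 r \<subseteq> box a b"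
    using open_box ab(2) open_contains_ball by blast
  have "\<forall>k. \<exists>L\<ge>0. \<forall>x\<in>cbox a b. \<forall>v. norm (frechet_derivative (Y k) (at x) v) \<le> L * norm v"
    using Ck_on_derivative_bounded_on_compact[OF Ck compact_cbox ab(1)] by metis
  then obtain L where L: "\<And>k. L k \<ge> 0"
    "\<And>k x v. x \<in> cbox a b \<Longrightarrow> norm (frechet_derivative (Y k) (at x) v) \<le> L k * norm v"
    by metis
  have "bounded (Y k ` cbox a b)" for k
    by (intro compact_imp_bounded compact_continuous_image compact_cbox
        continuous_on_subset[OF Ck_on_imp_continuous_on[OF Ck] ab(1)])
  then have "\<forall>k. \<exists>C>0. \<forall>x\<in>cbox a b. norm (Y k x) \<le> C"
    unfolding bounded_pos by simp
  then obtain C where C: "\<And>k. C k > 0" "\<And>k x. x \<in> cbox a b \<Longrightarrow> norm (Y k x) \<le> C k"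
    by metis
  \<comment> \<open>Sums of nonnegative bounds serve as bounds uniform in \<open>k\<close>.\<close>
  define L' where "L' = sum L UNIV"
  define C' where "C' = sum C UNIV"
  have L': "L k \<le> L'" "L' \<ge> 0" for k
    using L(1) by (auto simp: L'_def intro: member_le_sum sum_nonneg)
  have "C k \<ge> 0" for k
    using C(1)[of k] by simp
  then have C': "C k \<le> C'" "C' \<ge> 0" for k
    by (auto simp: C'_def intro: member_le_sum sum_nonneg)
  \<comment> \<open>Two steps of length at most \<open>r / 4\<close> from the centre remain inside
    the ball of radius \<open>r\<close>.\<close>
  define \<epsilon> where "\<epsilon> = r / 4"
  define n where "n = real CARD('p)"
  \<comment> \<open>The two entries solve the two smallness conditions for \<open>\<delta>\<close>;
    adding 1 keeps the denominators positive knowing only \<open>L' \<ge> 0\<close> and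
    \<open>C' \<ge> 0\<close>.\<close>
  define \<delta> where "\<delta> = min (1 / (2 * n * (L' + 1))) (\<epsilon> / (n * (C' + 1)))"
  have n: "n > 0" by (simp add: n_def)
  have \<delta>: "\<delta> > 0"
    using n L' C' r by (simp add: \<delta>_def \<epsilon>_def)
  have "\<delta> \<le> 1 / (2 * n * (L' + 1))" "\<delta> \<le> \<epsilon> / (n * (C' + 1))"
    by (simp_all only: \<delta>_def min.cobounded1 min.cobounded2)
  then have "\<delta> * (2 * n * (L' + 1)) \<le> 1" "\<delta> * (n * (C' + 1)) \<le> \<epsilon>"
    using n L'(2) C'(2) by (simp_all add: pos_le_divide_eq)
  then have bounds: "n * (\<delta> * L') \<le> 1/2" "n * (\<delta> * C') \<le> \<epsilon>"
    using mult_pos_pos[OF n \<delta>] by (simp_all add: algebra_simps)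
  have "flow_box \<Omega> a b x\<^sub>0 Y L' C' \<delta> \<epsilon>"
  proof
    show "norm (frechet_derivative (Y k) (at x) v) \<le> L' * norm v" if "x \<in> cbox a b" for x k v
      using L(2)[OF that, of k v] mult_right_mono[OF L'(1)[of k] norm_ge_zero[of v]] by linarith
    show "norm (Y k x) \<le> C'" if "x \<in> cbox a b" for x k
      using C(2)[OF that, of k] C'(1)[of k] by linarith
    show "y \<in> cbox a b" if "x \<in> ball x\<^sub>0 \<epsilon>" "dist x y \<le> \<epsilon>" for x y
    proof -
      have "dist x\<^sub>0 y < r"
        using that dist_triangle[of x\<^sub>0 y x] r(1) by (simp add: \<epsilon>_def)
      then show ?thesis
        using r(2) box_subset_cbox[of a b] by (auto simp: subset_iff)
    qed
  qed (use \<Omega> ab smooth L' C' \<delta> bounds r in \<open>simp_all add: \<epsilon>_def n_def\<close>)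
  then show ?thesis by (rule that)
qed

subsection \<open>Commutators and diffeomorphisms\<close>

text \<open>Each term differentiates one field in the moving direction of the other, hence the basis
  expansion. The bracket costs one order of differentiability, which smooth fields can
  afford.\<close>

lemma smooth_on_lie_bracket:
  assumes "open S" "smooth_on S X" "smooth_on S Y"
  shows "smooth_on S (lie_bracket X Y)"
  unfolding smooth_on_def
proof
  fix k
  have Ck: "Ck_on k S X" "Ck_on k S Y" "Ck_on (Suc k) S X" "Ck_on (Suc k) S Y"
    using assms(2,3) unfolding smooth_on_def by blast+
  let ?B = "\<lambda>x. (\<Sum>i\<in>Basis. (X x \<bullet> i) *\<^sub>R frechet_derivative Y (at x) i) -
    (\<Sum>i\<in>Basis. (Y x \<bullet> i) *\<^sub>R frechet_derivative X (at x) i)"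
  show "Ck_on k S (lie_bracket X Y)"
  proof (rule Ck_on_cong[OF assms(1)])
    show "?B x = lie_bracket X Y x" if "x \<in> S" for x
      by (simp only: lie_bracket_def Ck_on_expansion[OF Ck(4) that, of "X x"]
          Ck_on_expansion[OF Ck(3) that, of "Y x"])
    show "Ck_on k S ?B"
      by (intro Ck_on_diff Ck_on_sum assms(1) Ck_on_bilinear[OF assms(1) bounded_bilinear_scaleR]
          Ck_on_bounded_linear[OF assms(1) bounded_linear_inner_left]
          Ck_on_frechet_derivative[OF Ck(3)] Ck_on_frechet_derivative[OF Ck(4)] Ck(1,2))
  qed
qed

lemma smooth_on_comm_field:
  assumes "open S" "I \<noteq> []" "\<And>i. i \<in> set I \<Longrightarrow> smooth_on S (X i)"
  shows "smooth_on S (comm_field X I)"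
  using assms(2,3)
proof (induction I rule: induct_list012)
  case (3 i j I)
  have "comm_field X (i # j # I) = lie_bracket (X i) (comm_field X (j # I))"
    by (simp add: comm_field_def)
  then show ?case
    using 3 by (simp add: smooth_on_lie_bracket[OF assms(1)])
qed (auto simp: comm_field_def)

lemma smooth_on_compose:
  fixes f :: "'a::euclidean_space \<Rightarrow> 'b::euclidean_space"
  assumes "open S" "open T" "f ` S \<subseteq> T" "smooth_on S f" "smooth_on T g"
  shows "smooth_on S (\<lambda>x. g (f x))"
  using assms Ck_on_compose unfolding smooth_on_def by blast

lemma smooth_on_Pair_left: "open S \<Longrightarrow> smooth_on S (\<lambda>y. (c, y))"
  unfolding smooth_on_def
  by (intro allI Ck_on_Pair Ck_on_const Ck_on_linear bounded_linear_ident)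

lemma smooth_on_Pair_right: "open S \<Longrightarrow> smooth_on S (\<lambda>x. (x, c))"
  unfolding smooth_on_def
  by (intro allI Ck_on_Pair Ck_on_const Ck_on_linear bounded_linear_ident)

lemma diffeomorphismI:
  assumes "open S" "open T" "smooth_on S f" "smooth_on T g"
    and f: "\<And>x. x \<in> S \<Longrightarrow> f x \<in> T \<and> g (f x) = x"
    and g: "\<And>y. y \<in> T \<Longrightarrow> g y \<in> S \<and> f (g y) = y"
  shows "diffeomorphism S T f"
proof -
  have bij: "bij_betw f S T"
    using f g by (intro bij_betw_byWitness[of S g f T]) auto
  have "inv_into S f y = g y" if "y \<in> T" for y
    using bij g[OF that] by (intro inv_into_f_eq) (auto simp: bij_betw_def)
  then have "smooth_on T (inv_into S f)"
    using assms(4) Ck_on_cong[OF assms(2), of g "inv_into S f"] unfolding smooth_on_def by metis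
  with assms bij show ?thesis
    by (simp add: diffeomorphism_def)
qed

text \<open>Carries the statement about slices in the second variable over to the first through
  \<open>\<Theta> (\<eta>, \<xi>) = - \<Theta> (\<xi>, \<eta>)\<close>.\<close>

lemma diffeomorphism_uminus:
  assumes f: "diffeomorphism S T f" and h: "\<And>x. x \<in> S \<Longrightarrow> h x = - f x"
  shows "diffeomorphism S (uminus ` T) h"
proof -
  have S: "open S" "open T" "bij_betw f S T" "smooth_on S f" "smooth_on T (inv_into S f)"
    using f by (auto simp: diffeomorphism_def)
  have T: "open (uminus ` T)"
    using S(2) by (rule open_negations)
  show ?thesis
  proof (rule diffeomorphismI[OF S(1) T])
    have "Ck_on k S (\<lambda>x. - f x)" for k
      using S(1,4) unfolding smooth_on_def
      by (intro Ck_on_bounded_linear[OF _ bounded_linear_minus[OF bounded_linear_ident]]) auto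
    then show "smooth_on S h"
      unfolding smooth_on_def using Ck_on_cong[OF S(1), of "\<lambda>x. - f x" h] h by simp
    have um: "smooth_on (uminus ` T) uminus"
      unfolding smooth_on_def by (intro allI Ck_on_linear T bounded_linear_minus bounded_linear_ident)
    show "smooth_on (uminus ` T) (\<lambda>y. inv_into S f (- y))"
      by (rule smooth_on_compose[OF T S(2) _ um S(5)]) auto
  qed (use S(3) h in \<open>auto simp: bij_betw_def inv_into_into f_inv_into_f\<close>)
qed

section \<open>Exponential coordinates near a point of the diagonal\<close>

theorem proposition11:
  fixes X :: "nat \<Rightarrow> real^'p \<Rightarrow> real^'p"
    and \<Omega> :: "(real^'p) set"
    and n r :: nat
    and B :: "nat list set"
    and idx :: "'p::finite \<Rightarrow> nat list"
    and \<xi>\<^sub>0 :: "real^'p"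
  assumes domain: "open \<Omega>" "connected \<Omega>"
    and smooth: "\<And>i. i \<le> n \<Longrightarrow> smooth_on \<Omega> (X i)"
    and free: "free_up_to_weight n r \<Omega> X"
    and hoermander: "hoermander_condition n r \<Omega> X"
    and B: "B \<subseteq> multiindices n r" "card B = CARD('p)" "pointwise_basis \<Omega> X B"
    and idx: "bij_betw idx UNIV B"
    and base_point: "\<xi>\<^sub>0 \<in> \<Omega>"
  shows "\<exists>(W :: ((real^'p) \<times> (real^'p)) set) (U :: (real^'p) set)
            (\<Theta> :: (real^'p) \<times> (real^'p) \<Rightarrow> real^'p).
      (open W \<and> (\<xi>\<^sub>0, \<xi>\<^sub>0) \<in> W \<and> open U \<and> 0 \<in> U \<and>
       \<Theta> ` W \<subseteq> U \<and> smooth_on W \<Theta> \<and>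
       (\<forall>(\<eta>, \<xi>)\<in>W.
          has_exp \<Omega> (\<lambda>x. \<Sum>k\<in>UNIV. (\<Theta> (\<eta>, \<xi>) $ k) *\<^sub>R comm_field X (idx k) x) \<eta> \<xi>)) \<and>
      (\<forall>(\<eta>, \<xi>)\<in>W. (\<xi>, \<eta>) \<in> W \<and> \<Theta> (\<eta>, \<xi>) = - \<Theta> (\<xi>, \<eta>)) \<and>
      (\<forall>\<eta>\<in>fst ` W. \<exists>V V'. \<eta> \<in> V \<and> 0 \<in> V' \<and> {\<eta>} \<times> V \<subseteq> W \<and>
          diffeomorphism V V' (\<lambda>\<xi>. \<Theta> (\<eta>, \<xi>))) \<and>
      (\<forall>\<xi>\<in>snd ` W. \<exists>V V'. \<xi> \<in> V \<and> 0 \<in> V' \<and> V \<times> {\<xi>} \<subseteq> W \<and>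
          diffeomorphism V V' (\<lambda>\<eta>. \<Theta> (\<eta>, \<xi>)))"
proof -
  define Y where "Y k = comm_field X (idx k)" for k
  have "smooth_on \<Omega> (Y k)" for k
  proof -
    have "idx k \<in> multiindices n r"
      using idx B(1) by (auto simp: bij_betw_def)
    then show ?thesis
      unfolding Y_def multiindices_def
      by (intro smooth_on_comm_field domain(1) smooth) auto
  qed
  then obtain a b L C \<delta> \<epsilon> where "flow_box \<Omega> a b \<xi>\<^sub>0 Y L C \<delta> \<epsilon>"
    using flow_box_exists[OF domain(1) base_point] by metis
  then interpret flow_box \<Omega> a b \<xi>\<^sub>0 Y L C \<delta> \<epsilon> .
  define \<Phi> where "\<Phi> z = (snd z, flow z)" for z :: "(real^'p) \<times> (real^'p)"
  have "Ck_on m params \<Phi>" for m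
    unfolding \<Phi>_def[abs_def]
    by (intro Ck_on_Pair Ck_on_linear open_params bounded_linear_snd Ck_on_flow)
  then have smooth_\<Phi>: "smooth_on params \<Phi>"
    by (simp add: smooth_on_def)
  have base: "(0, \<xi>\<^sub>0) \<in> params"
    using delta(1) eps(1) by (simp add: params_def)
  have inj: "v = 0" if "frechet_derivative \<Phi> (at (0, \<xi>\<^sub>0)) v = 0" for v
  proof -
    let ?Y = "\<lambda>u :: real^'p. \<Sum>k\<in>UNIV. (u $ k) *\<^sub>R Y k \<xi>\<^sub>0"
    have "(\<Phi> has_derivative (\<lambda>h. (snd h, snd h + ?Y (fst h)))) (at (0, \<xi>\<^sub>0))"
      unfolding \<Phi>_def[abs_def] using eps(1)
      by (intro has_derivative_Pair has_derivative_snd has_derivative_ident flow_has_derivative_at_zero) simp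
    then have "frechet_derivative \<Phi> (at (0, \<xi>\<^sub>0)) = (\<lambda>h. (snd h, snd h + ?Y (fst h)))"
      by (rule frechet_derivative_at[symmetric])
    with that have v: "snd v = 0" "?Y (fst v) = 0"
      by (auto simp: prod_eq_iff)
    have lin: "linear ?Y"
      by (rule linearI) (simp_all add: scaleR_left_distrib sum.distrib scaleR_sum_right)
    \<comment> \<open>A kernel vector has second component 0 and first component in the kernel of
      \<open>?Y\<close>, so injectivity of \<open>?Y\<close> remains. It is onto because the fields
      indexed by \<open>B\<close> span, and a surjective linear endomorphism of a finite-dimensional
      space is injective.\<close>
    have "(\<lambda>I. comm_field X I \<xi>\<^sub>0) ` B \<subseteq> range ?Y"
    proof
      fix y assume "y \<in> (\<lambda>I. comm_field X I \<xi>\<^sub>0) ` B"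
      then obtain k where "y = Y k \<xi>\<^sub>0"
        using idx by (auto simp: bij_betw_def Y_def)
      also have "\<dots> = ?Y (axis k 1)"
        by (simp add: axis_def if_distrib[of "\<lambda>c. c *\<^sub>R _"] cong: if_cong)
      finally show "y \<in> range ?Y"
        by blast
    qed
    then have "span ((\<lambda>I. comm_field X I \<xi>\<^sub>0) ` B) \<subseteq> range ?Y"
      by (rule span_minimal) (rule linear_subspace_image[OF lin subspace_UNIV])
    then have "surj ?Y"
      using B(3) base_point by (auto simp: pointwise_basis_def)
    then have "inj ?Y"
      using lin by (simp add: linear_surjective_imp_injective)
    then have "fst v = 0"
      using injD[OF \<open>inj ?Y\<close>, of "fst v" 0] v(2) by simp
    with v(1) show ?thesis
      by (simp add: prod_eq_iff)
  qed
  obtain Q R g where Q: "open Q" "(0, \<xi>\<^sub>0) \<in> Q" "Q \<subseteq> params" "open R" "homeomorphism Q R \<Phi> g" "smooth_on R g"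
    using smooth_local_inverse[OF open_params base smooth_\<Phi> inj] by metis
  \<comment> \<open>A product neighbourhood contains \<open>(0, \<eta>)\<close> along with any of
    its points \<open>(u, \<eta>)\<close>. This puts 0 into the range of every slice, not only of
    the one through the base point.\<close>
  obtain M M' where M: "open M" "open M'" "(0, \<xi>\<^sub>0) \<in> M \<times> M'" "M \<times> M' \<subseteq> Q"
    using open_prod_elim[OF Q(1,2)] by metis
  define \<sigma> where "\<sigma> z = (- fst z, flow z)" for z :: "(real^'p) \<times> (real^'p)"
  \<comment> \<open>Time reversal \<open>\<sigma>\<close> is an involution on \<open>params\<close>,
    so intersecting with the preimage makes \<open>G\<close> invariant under
    \<open>\<sigma>\<close>; it still contains each \<open>(0, \<eta>)\<close> with
    \<open>\<eta> \<in> M'\<close>, a fixed point of \<open>\<sigma>\<close>.\<close>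
  define G where "G = M \<times> M' \<inter> \<sigma> -` (M \<times> M')"
  \<comment> \<open>This is the image of \<open>G\<close> under \<open>\<Phi>\<close>. Since
    \<open>\<Phi>\<close> turns \<open>\<sigma>\<close> into the exchange of the two points,
    \<open>W\<close> is symmetric.\<close>
  define W where "W = R \<inter> g -` G"
  define \<Theta> where "\<Theta> y = fst (g y)" for y
  have cont_flow: "continuous_on params flow"
    by (rule Ck_on_imp_continuous_on[OF Ck_on_flow])
  have "open G"
    unfolding G_def \<sigma>_def[abs_def]
    using M Q(3) by (intro continuous_open_preimage open_Times continuous_intros continuous_on_subset[OF cont_flow]) auto
  have GQ: "G \<subseteq> Q" "G \<subseteq> params"
    using M(4) Q(3) by (auto simp: G_def)
  have "open W"
    unfolding W_def using Q(4,5) \<open>open G\<close>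
    by (intro continuous_open_preimage) (auto simp: homeomorphism_def)
  have \<sigma>\<sigma>: "flow (\<sigma> z) = snd z" if "z \<in> params" for z
    using that flow_reverse[of "fst z" "snd z"] by (auto simp: \<sigma>_def params_def)
  have \<sigma>G: "\<sigma> z \<in> G" if "z \<in> G" for z
  proof -
    have "\<sigma> (\<sigma> z) = z"
      using \<sigma>\<sigma>[of z] that GQ(2) by (auto simp: \<sigma>_def prod_eq_iff)
    with that show ?thesis
      by (simp add: G_def)
  qed
  have WI: "\<Phi> z \<in> W \<and> g (\<Phi> z) = z" if "z \<in> G" for z
    using that GQ(1) Q(5) by (auto simp: W_def homeomorphism_def)
  have WD: "g (\<eta>, \<xi>) = (\<Theta> (\<eta>, \<xi>), \<eta>) \<and> (\<Theta> (\<eta>, \<xi>), \<eta>) \<in> G \<and> flow (\<Theta> (\<eta>, \<xi>), \<eta>) = \<xi>"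
    if "(\<eta>, \<xi>) \<in> W" for \<eta> \<xi>
  proof -
    have "\<Phi> (g (\<eta>, \<xi>)) = (\<eta>, \<xi>)" "g (\<eta>, \<xi>) \<in> G"
      using that Q(5) by (auto simp: W_def homeomorphism_def)
    moreover from this have "g (\<eta>, \<xi>) = (\<Theta> (\<eta>, \<xi>), \<eta>)"
      by (simp add: \<Phi>_def \<Theta>_def prod_eq_iff)
    ultimately show ?thesis
      by (simp add: \<Phi>_def)
  qed
  have zero_G: "(0, \<eta>) \<in> G" if "\<eta> \<in> M'" for \<eta>
    using that M(3) by (simp add: G_def \<sigma>_def flow_zero)
  have sym: "(\<xi>, \<eta>) \<in> W \<and> \<Theta> (\<eta>, \<xi>) = - \<Theta> (\<xi>, \<eta>)" if "(\<eta>, \<xi>) \<in> W" for \<eta> \<xi>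
  proof -
    let ?z = "(\<Theta> (\<eta>, \<xi>), \<eta>)"
    have z: "?z \<in> G" "flow ?z = \<xi>"
      using WD[OF that] by auto
    have "\<Phi> (\<sigma> ?z) = (\<xi>, \<eta>)"
      using \<sigma>\<sigma>[of ?z] z GQ(2) by (auto simp: \<Phi>_def \<sigma>_def)
    moreover have "fst (\<sigma> ?z) = - \<Theta> (\<eta>, \<xi>)"
      by (simp add: \<sigma>_def)
    ultimately show ?thesis
      using WI[OF \<sigma>G[OF z(1)]] by (auto simp: \<Theta>_def)
  qed
  have smooth_\<Theta>: "smooth_on W \<Theta>"
    using Q(6) Q(4) unfolding smooth_on_def \<Theta>_def[abs_def] W_def
    by (auto intro: Ck_on_subset Ck_on_bounded_linear[OF _ bounded_linear_fst])
  have diffeo: "\<exists>V V'. \<eta> \<in> V \<and> 0 \<in> V' \<and> {\<eta>} \<times> V \<subseteq> W \<and> diffeomorphism V V' (\<lambda>\<xi>. \<Theta> (\<eta>, \<xi>))"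
    if "\<eta> \<in> fst ` W" for \<eta>
  proof -
    obtain \<xi> where "(\<eta>, \<xi>) \<in> W"
      using \<open>\<eta> \<in> fst ` W\<close> by auto
    then have "\<eta> \<in> M'"
      using WD by (auto simp: G_def)
    \<comment> \<open>Slices of \<open>W\<close> and of \<open>G\<close> over the same
      \<open>\<eta>\<close>; the inverse of the slice map is
      \<open>u \<mapsto> flow (u, \<eta>)\<close>.\<close>
    define V where "V = {\<xi>. (\<eta>, \<xi>) \<in> W}"
    define V' where "V' = {u. (u, \<eta>) \<in> G}"
    have "open (Pair \<eta> -` W)" "open ((\<lambda>u. (u, \<eta>)) -` G)"
      using \<open>open W\<close> \<open>open G\<close> by (auto intro!: open_vimage continuous_intros)
    then have V: "open V" "open V'"
      by (auto simp: V_def V'_def vimage_def)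
    have "diffeomorphism V V' (\<lambda>\<xi>. \<Theta> (\<eta>, \<xi>))"
    proof (rule diffeomorphismI[OF V])
      show "smooth_on V (\<lambda>\<xi>. \<Theta> (\<eta>, \<xi>))"
        by (rule smooth_on_compose[OF V(1) \<open>open W\<close> _ smooth_on_Pair_left[OF V(1)] smooth_\<Theta>])
          (auto simp: V_def)
      show "smooth_on V' (\<lambda>u. flow (u, \<eta>))"
        using GQ(2) Ck_on_flow
        by (intro smooth_on_compose[OF V(2) open_params _ smooth_on_Pair_right[OF V(2)]])
          (auto simp: V'_def smooth_on_def)
      show "\<Theta> (\<eta>, \<xi>) \<in> V' \<and> flow (\<Theta> (\<eta>, \<xi>), \<eta>) = \<xi>" if "\<xi> \<in> V" for \<xi>
        using WD that by (auto simp: V_def V'_def)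
      show "flow (u, \<eta>) \<in> V \<and> \<Theta> (\<eta>, flow (u, \<eta>)) = u" if "u \<in> V'" for u
        using WI[of "(u, \<eta>)"] that by (auto simp: V_def V'_def \<Phi>_def \<Theta>_def)
    qed
    moreover have "0 \<in> V'" "\<eta> \<in> V"
      using zero_G[OF \<open>\<eta> \<in> M'\<close>] WI[OF zero_G[OF \<open>\<eta> \<in> M'\<close>]] by (auto simp: V_def V'_def \<Phi>_def flow_zero)
    moreover have "{\<eta>} \<times> V \<subseteq> W"
      by (auto simp: V_def)
    ultimately show ?thesis by blast
  qed
  show ?thesis
  \<comment> \<open>The codomain has only to be an open set around 0 that contains the values of
    \<open>\<Theta>\<close>; the exact ranges are the sets \<open>V'\<close> of the slices.\<close>
  proof (intro exI[of _ W] exI[of _ UNIV] exI[of _ \<Theta>] conjI)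
    show "open W" by fact
    show "smooth_on W \<Theta>" by fact
    show "\<forall>(\<eta>, \<xi>)\<in>W. (\<xi>, \<eta>) \<in> W \<and> \<Theta> (\<eta>, \<xi>) = - \<Theta> (\<xi>, \<eta>)"
      using sym by blast
    show "\<forall>\<eta>\<in>fst ` W. \<exists>V V'. \<eta> \<in> V \<and> 0 \<in> V' \<and> {\<eta>} \<times> V \<subseteq> W \<and> diffeomorphism V V' (\<lambda>\<xi>. \<Theta> (\<eta>, \<xi>))"
      by (intro ballI diffeo)
    show "(\<xi>\<^sub>0, \<xi>\<^sub>0) \<in> W"
      using WI[OF zero_G[of \<xi>\<^sub>0]] M(3) by (simp add: \<Phi>_def flow_zero)
    show "\<forall>(\<eta>, \<xi>)\<in>W. has_exp \<Omega> (\<lambda>x. \<Sum>k\<in>UNIV. (\<Theta> (\<eta>, \<xi>) $ k) *\<^sub>R comm_field X (idx k) x) \<eta> \<xi>"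
    proof clarify
      fix \<eta> \<xi> assume "(\<eta>, \<xi>) \<in> W"
      from WD[OF this] GQ(2) have "(\<Theta> (\<eta>, \<xi>), \<eta>) \<in> params" "flow (\<Theta> (\<eta>, \<xi>), \<eta>) = \<xi>"
        by auto
      then show "has_exp \<Omega> (\<lambda>x. \<Sum>k\<in>UNIV. (\<Theta> (\<eta>, \<xi>) $ k) *\<^sub>R comm_field X (idx k) x) \<eta> \<xi>"
        using has_exp_flow[of "(\<Theta> (\<eta>, \<xi>), \<eta>)"] by (simp add: Y_def)
    qed
    show "\<forall>\<xi>\<in>snd ` W. \<exists>V V'. \<xi> \<in> V \<and> 0 \<in> V' \<and> V \<times> {\<xi>} \<subseteq> W \<and> diffeomorphism V V' (\<lambda>\<eta>. \<Theta> (\<eta>, \<xi>))"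
    proof
      fix \<xi> assume "\<xi> \<in> snd ` W"
      \<comment> \<open>By symmetry of \<open>W\<close> both projections agree, so the slice through
        \<open>\<xi>\<close> already constructed can be reflected.\<close>
      then have "\<xi> \<in> fst ` W"
        using sym by force
      from diffeo[OF this] obtain V V' where V: "\<xi> \<in> V" "0 \<in> V'" "{\<xi>} \<times> V \<subseteq> W" "diffeomorphism V V' (\<lambda>\<eta>. \<Theta> (\<xi>, \<eta>))"
        by (elim exE conjE) (rule that)
      have "V \<times> {\<xi>} \<subseteq> W" "\<And>\<eta>. \<eta> \<in> V \<Longrightarrow> \<Theta> (\<eta>, \<xi>) = - \<Theta> (\<xi>, \<eta>)"
        using V(3) sym by blast+
      moreover from this(2) have "diffeomorphism V (uminus ` V') (\<lambda>\<eta>. \<Theta> (\<eta>, \<xi>))"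
        by (rule diffeomorphism_uminus[OF V(4)])
      moreover have "0 \<in> uminus ` V'"
        using V(2) by force
      ultimately show "\<exists>V V'. \<xi> \<in> V \<and> 0 \<in> V' \<and> V \<times> {\<xi>} \<subseteq> W \<and> diffeomorphism V V' (\<lambda>\<eta>. \<Theta> (\<eta>, \<xi>))"
        by (intro exI[of _ V] exI[of _ "uminus ` V'"] conjI V(1))
    qed
    show "open (UNIV :: (real^'p) set)" "(0 :: real^'p) \<in> UNIV" "\<Theta> ` W \<subseteq> UNIV"
      by (rule open_UNIV UNIV_I subset_UNIV)+
  qed
qed

end
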